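(* Let $\Bbbk$ be a commutative ring, let $A$ be a $\Bbbk$-algebra, let $Q$ be a quiver, let $R$ be a set of relations of the free category $\mathbb{P}Q$, and let $I=\langle Q\mid R\rangle$ be the (small) category presented by $Q$ and $R$. Let $\Delta(A)\colon I\to \Bbbk\text{-}\mathbf{Cat}$ be the diagonal functor of $A$. Then there is an isomorphism of $\Bbbk$-categories $$\operatorname{Gr}(\Delta(A))\cong AQ/\langle R\rangle_A,$$ where $\operatorname{Gr}(\Delta(A))$ is the Grothendieck construction of $\Delta(A)$, $AQ$ is the quiver algebra of $Q$ over $A$ (regarded as a $\Bbbk$-category with object set $Q_0$), and $\langle R\rangle_A$ is the ideal of $AQ$ generated by the elements $g-h$ with $(g,h)\in R$.
   Context: **$\Bbbk$-categories.** A $\Bbbk$-category is a category whose morphism sets are $\Bbbk$-modules and whose compositions are $\Bbbk$-bilinear. $\Bbbk\text{-}\mathbf{Cat}$ is the 2-category of all $\Bbbk$-categories, $\Bbbk$-functors ($\Bbbk$-linear functors) and natural transformations. The $\Bbbk$-algebra $A$ is regarded as a $\Bbbk$-category with a single object $*$ and $A( *,* )=A$, composition being multiplication. **Quivers and presentations.** A quiver $Q=(Q_0,Q_1,t,h)$ has vertex set $Q_0$, arrow set $Q_1$, and tail and head maps $t,h$. Paths are written from right to left: $\alpha_n\cdots\alpha_1$ has first arrow $\alpha_1$. The free category $\mathbb{P}Q$ has object set $Q_0$ and all paths of $Q$ (including the length $0$ paths $e_i$, $i\in Q_0$) as morphisms, with the usual composition of paths. For a category $\mathcal{C}$, a relation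 of $\mathcal{C}$ is an element of $\bigcup_{i,j}\mathcal{C}(i,j)\times\mathcal{C}(i,j)$. For a set $R$ of relations, $R(i,j):=R\cap(\mathcal{C}(i,j)\times\mathcal{C}(i,j))$ and $$R^c:=\bigcup_{i,j}\{(dac,dbc)\mid c\in\mathcal{C}(-,i),\ d\in\mathcal{C}(j,-),\ (a,b)\in R(i,j)\}.$$ $R^\#$ is the equivalence relation generated by $R^c$ (on each morphism set $\mathcal{C}(i,j)$, the smallest equivalence relation containing $R^c(i,j)$). The category $\mathcal{C}/R^\#$ has the same objects as $\mathcal{C}$, morphism sets $\mathcal{C}(i,j)/R^\#(i,j)$, and composition induced from $\mathcal{C}$. For $R$ a set of relations of $\mathbb{P}Q$, $\langle Q\mid R\rangle:=\mathbb{P}Q/R^\#$. **Grothendieck construction.** For a functor $X\colon I\to\Bbbk\text{-}\mathbf{Cat}$, the category $\operatorname{Gr}(X)$ has objects the pairs $(i,x)$ with $i$ an object of $I$ and $x$ an object of $X(i)$; morphisms $$\operatorname{Gr}(X)((i,x),(j,y)):=\bigoplus_{a\in I(i,j)}X(j)(X(a)x,y);$$ and composition, for $f=(f_a)_{a\in I(i,j)}\colon(i,x)\to(j,y)$ and $g=(g_b)_{b\in I(j,k)}\colon(j,y)\to(k,z)$, $$g\circ f:=\Bigl(\sum_{c=ba,\ a\in I(i,j),\ b\in I(j,k)}g_b\circ X(b)(f_a)\Bigr)_{c\in I(i,k)}.$$ **Diagonal functor.** For a $\Bbbk$-category $\mathcal{C}$, $\Delta(\mathcal{C})\colon I\to\Bbbk\text{-}\mathbf{Cat}$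 sends every object of $I$ to $\mathcal{C}$ and every morphism of $I$ to the identity functor of $\mathcal{C}$. **Quiver algebra.** $\Bbbk Q$ is the $\Bbbk$-linearization of $\mathbb{P}Q$, and $AQ:=A\otimes_\Bbbk\Bbbk Q$ is the $A$-linearization of $\mathbb{P}Q$: its object set is $Q_0$, $AQ(i,j)=\bigoplus_{\mu\in\mathbb{P}Q(i,j)}A\mu$, and composition is determined by $(b\,\beta)(a\,\alpha)=(ba)\,\beta\alpha$ for $a,b\in A$ and composable paths $\alpha,\beta$. The ideal is $\langle R\rangle_A:=AQ\{g-h\mid(g,h)\in R\}AQ$, i.e. the two-sided ideal of the $\Bbbk$-category $AQ$ generated by these elements. $AQ/\langle R\rangle_A$ is the quotient $\Bbbk$-category. *)

theory Defs
  imports "HOL-Algebra.Module" "HOL-Algebra.AbelCoset" "HOL-Library.FuncSet"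
    "Graph_Theory.Arc_Walk"
begin

section \<open>Categories and functors\<close>

text \<open>
  Morphism sets are not assumed to be disjoint, so composition and the action of functors
  on morphisms take the objects as arguments: \<open>ccomp C i j k g f\<close> is \<open>g\<close> after \<open>f\<close>
  for \<open>f : i \<rightarrow> j\<close> and \<open>g : j \<rightarrow> k\<close>.
\<close>

record ('o, 'm) cat =
  cobj :: "'o set"
  chom :: "'o \<Rightarrow> 'o \<Rightarrow> 'm set"
  cid :: "'o \<Rightarrow> 'm"
  ccomp :: "'o \<Rightarrow> 'o \<Rightarrow> 'o \<Rightarrow> 'm \<Rightarrow> 'm \<Rightarrow> 'm"

locale category =
  fixes C :: "('o, 'm) cat"
  assumes id_closed: "i \<in> cobj C \<Longrightarrow> cid C i \<in> chom C i i"
    and comp_closed: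
      "\<lbrakk>i \<in> cobj C; j \<in> cobj C; k \<in> cobj C; f \<in> chom C i j; g \<in> chom C j k\<rbrakk>
        \<Longrightarrow> ccomp C i j k g f \<in> chom C i k"
    and id_right: "\<lbrakk>i \<in> cobj C; j \<in> cobj C; f \<in> chom C i j\<rbrakk> \<Longrightarrow> ccomp C i i j f (cid C i) = f"
    and id_left: "\<lbrakk>i \<in> cobj C; j \<in> cobj C; f \<in> chom C i j\<rbrakk> \<Longrightarrow> ccomp C i j j (cid C j) f = f"
    and comp_assoc:
      "\<lbrakk>i \<in> cobj C; j \<in> cobj C; k \<in> cobj C; l \<in> cobj C;
        f \<in> chom C i j; g \<in> chom C j k; h \<in> chom C k l\<rbrakk>
        \<Longrightarrow> ccomp C i k l h (ccomp C i j k g f) = ccomp C i j l (ccomp C j k l h g) f"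

record ('o, 'm, 'p, 'n) fdata =
  fobj :: "'o \<Rightarrow> 'p"
  fmor :: "'o \<Rightarrow> 'o \<Rightarrow> 'm \<Rightarrow> 'n"

locale cat_functor = source: category C + target: category D
  for C :: "('o, 'm) cat" and D :: "('p, 'n) cat" +
  fixes F :: "('o, 'm, 'p, 'n) fdata"
  assumes obj_closed: "i \<in> cobj C \<Longrightarrow> fobj F i \<in> cobj D"
    and mor_closed:
      "\<lbrakk>i \<in> cobj C; j \<in> cobj C; f \<in> chom C i j\<rbrakk>
        \<Longrightarrow> fmor F i j f \<in> chom D (fobj F i) (fobj F j)"
    and mor_id: "i \<in> cobj C \<Longrightarrow> fmor F i i (cid C i) = cid D (fobj F i)"
    and mor_comp:
      "\<lbrakk>i \<in> cobj C; j \<in> cobj C; k \<in> cobj C; f \<in> chom C i j; g \<in> chom C j k\<rbrakk>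
        \<Longrightarrow> fmor F i k (ccomp C i j k g f)
          = ccomp D (fobj F i) (fobj F j) (fobj F k) (fmor F j k g) (fmor F i j f)"

definition functor_id :: "('o, 'm, 'o, 'm) fdata" where
  "functor_id = \<lparr>fobj = \<lambda>i. i, fmor = \<lambda>i j f. f\<rparr>"

definition functor_comp ::
  "('p, 'n, 'q, 'l) fdata \<Rightarrow> ('o, 'm, 'p, 'n) fdata \<Rightarrow> ('o, 'm, 'q, 'l) fdata" where
  "functor_comp G F =
    \<lparr>fobj = \<lambda>i. fobj G (fobj F i),
     fmor = \<lambda>i j f. fmor G (fobj F i) (fobj F j) (fmor F i j f)\<rparr>"

text \<open>
  Equality of functors with source \<open>C\<close>; the values of the underlying HOL functions outside
  the objects and morphisms of \<open>C\<close> are irrelevant.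
\<close>

definition functor_eq ::
  "('o, 'm) cat \<Rightarrow> ('o, 'm, 'p, 'n) fdata \<Rightarrow> ('o, 'm, 'p, 'n) fdata \<Rightarrow> bool" where
  "functor_eq C F G \<longleftrightarrow>
    (\<forall>i\<in>cobj C. fobj F i = fobj G i) \<and>
    (\<forall>i\<in>cobj C. \<forall>j\<in>cobj C. \<forall>f\<in>chom C i j. fmor F i j f = fmor G i j f)"


section \<open>\<open>K\<close>-categories\<close>

text \<open>
  Morphism modules reuse the \<open>module\<close> record of HOL-Algebra, whose \<open>mult\<close> and \<open>one\<close> fields
  play no role in \<^locale>\<open>Module.module\<close>.
\<close>

record ('k, 'o, 'm) kcat =
  kobj :: "'o set"
  khom :: "'o \<Rightarrow> 'o \<Rightarrow> ('k, 'm) module"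
  kid :: "'o \<Rightarrow> 'm"
  kcomp :: "'o \<Rightarrow> 'o \<Rightarrow> 'o \<Rightarrow> 'm \<Rightarrow> 'm \<Rightarrow> 'm"

definition under_cat :: "('k, 'o, 'm) kcat \<Rightarrow> ('o, 'm) cat" where
  "under_cat C =
    \<lparr>cobj = kobj C, chom = \<lambda>i j. carrier (khom C i j), cid = kid C, ccomp = kcomp C\<rparr>"

locale k_category = K?: cring K + cat?: category "under_cat C"
  for K :: "'k ring" and C :: "('k, 'o, 'm) kcat" +
  assumes hom_module: "\<lbrakk>i \<in> kobj C; j \<in> kobj C\<rbrakk> \<Longrightarrow> Module.module K (khom C i j)"
    and comp_add_right:
      "\<lbrakk>i \<in> kobj C; j \<in> kobj C; k \<in> kobj C; g \<in> carrier (khom C j k);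
        f \<in> carrier (khom C i j); f' \<in> carrier (khom C i j)\<rbrakk>
        \<Longrightarrow> kcomp C i j k g (f \<oplus>\<^bsub>khom C i j\<^esub> f')
          = kcomp C i j k g f \<oplus>\<^bsub>khom C i k\<^esub> kcomp C i j k g f'"
    and comp_add_left:
      "\<lbrakk>i \<in> kobj C; j \<in> kobj C; k \<in> kobj C; f \<in> carrier (khom C i j);
        g \<in> carrier (khom C j k); g' \<in> carrier (khom C j k)\<rbrakk>
        \<Longrightarrow> kcomp C i j k (g \<oplus>\<^bsub>khom C j k\<^esub> g') f
          = kcomp C i j k g f \<oplus>\<^bsub>khom C i k\<^esub> kcomp C i j k g' f"
    and comp_smult_right:
      "\<lbrakk>i \<in> kobj C; j \<in> kobj C; k \<in> kobj C; r \<in> carrier K;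
        f \<in> carrier (khom C i j); g \<in> carrier (khom C j k)\<rbrakk>
        \<Longrightarrow> kcomp C i j k g (r \<odot>\<^bsub>khom C i j\<^esub> f) = r \<odot>\<^bsub>khom C i k\<^esub> kcomp C i j k g f"
    and comp_smult_left:
      "\<lbrakk>i \<in> kobj C; j \<in> kobj C; k \<in> kobj C; r \<in> carrier K;
        f \<in> carrier (khom C i j); g \<in> carrier (khom C j k)\<rbrakk>
        \<Longrightarrow> kcomp C i j k (r \<odot>\<^bsub>khom C j k\<^esub> g) f = r \<odot>\<^bsub>khom C i k\<^esub> kcomp C i j k g f"

locale k_functor = source: k_category K C + target: k_category K D +
    functorial?: cat_functor "under_cat C" "under_cat D" F
  for K :: "'k ring" and C :: "('k, 'o, 'm) kcat" and D :: "('k, 'p, 'n) kcat"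
    and F :: "('o, 'm, 'p, 'n) fdata" +
  assumes mor_add:
      "\<lbrakk>i \<in> kobj C; j \<in> kobj C; f \<in> carrier (khom C i j); g \<in> carrier (khom C i j)\<rbrakk>
        \<Longrightarrow> fmor F i j (f \<oplus>\<^bsub>khom C i j\<^esub> g)
          = fmor F i j f \<oplus>\<^bsub>khom D (fobj F i) (fobj F j)\<^esub> fmor F i j g"
    and mor_smult:
      "\<lbrakk>i \<in> kobj C; j \<in> kobj C; r \<in> carrier K; f \<in> carrier (khom C i j)\<rbrakk>
        \<Longrightarrow> fmor F i j (r \<odot>\<^bsub>khom C i j\<^esub> f)
          = r \<odot>\<^bsub>khom D (fobj F i) (fobj F j)\<^esub> fmor F i j f"

text \<open>Isomorphism (not mere equivalence) of \<open>K\<close>-categories.\<close>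

definition k_isomorphic ::
  "'k ring \<Rightarrow> ('k, 'o, 'm) kcat \<Rightarrow> ('k, 'p, 'n) kcat \<Rightarrow> bool" where
  "k_isomorphic K C D \<longleftrightarrow>
    (\<exists>F G. k_functor K C D F \<and> k_functor K D C G \<and>
      functor_eq (under_cat C) (functor_comp G F) functor_id \<and>
      functor_eq (under_cat D) (functor_comp F G) functor_id)"

text \<open>
  Associative unital, not necessarily commutative algebras; the locale \<^locale>\<open>Module.algebra\<close> of
  HOL-Algebra demands commutativity.
\<close>

locale k_algebra = Module.module K A + ring A
  for K :: "'k ring" and A :: "('k, 'a) module" +
  assumes smult_mult_left:
      "\<lbrakk>r \<in> carrier K; x \<in> carrier A; y \<in> carrier A\<rbrakk>
        \<Longrightarrow> (r \<odot>\<^bsub>A\<^esub> x) \<otimes>\<^bsub>A\<^esub> y = r \<odot>\<^bsub>A\<^esub> (x \<otimes>\<^bsub>A\<^esub> y)"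
    and smult_mult_right:
      "\<lbrakk>r \<in> carrier K; x \<in> carrier A; y \<in> carrier A\<rbrakk>
        \<Longrightarrow> x \<otimes>\<^bsub>A\<^esub> (r \<odot>\<^bsub>A\<^esub> y) = r \<odot>\<^bsub>A\<^esub> (x \<otimes>\<^bsub>A\<^esub> y)"

definition algebra_kcat :: "('k, 'a) module \<Rightarrow> ('k, unit, 'a) kcat" where
  "algebra_kcat A =
    \<lparr>kobj = {()}, khom = \<lambda>_ _. A, kid = \<lambda>_. \<one>\<^bsub>A\<^esub>, kcomp = \<lambda>_ _ _ b a. b \<otimes>\<^bsub>A\<^esub> a\<rparr>"

lemma k_category_algebra_kcat:
  assumes "k_algebra K A"
  shows "k_category K (algebra_kcat A)"
proof -
  interpret A: k_algebra K A by fact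
  show ?thesis
    by (intro k_category.intro k_category_axioms.intro category.intro A.R.cring_axioms)
      (simp_all add: algebra_kcat_def under_cat_def A.module_axioms A.m_assoc A.l_distr
        A.r_distr A.smult_mult_left A.smult_mult_right)
qed


section \<open>Direct sums and the Grothendieck construction\<close>

text \<open>
  Elements of a direct sum are families of finite support, extended by \<^const>\<open>undefined\<close>
  outside the index set.
\<close>

definition direct_sum :: "'s set \<Rightarrow> ('s \<Rightarrow> ('k, 'm) module) \<Rightarrow> ('k, 's \<Rightarrow> 'm) module" where
  "direct_sum S M =
    \<lparr>carrier = {f \<in> \<Pi>\<^sub>E a\<in>S. carrier (M a). finite {a \<in> S. f a \<noteq> \<zero>\<^bsub>M a\<^esub>}},
     mult = undefined,
     one = undefined,
     zero = (\<lambda>a\<in>S. \<zero>\<^bsub>M a\<^esub>),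
     add = (\<lambda>f g. \<lambda>a\<in>S. f a \<oplus>\<^bsub>M a\<^esub> g a),
     smult = (\<lambda>r f. \<lambda>a\<in>S. r \<odot>\<^bsub>M a\<^esub> f a)\<rparr>"

text \<open>Functors from a category to the category of \<open>K\<close>-categories.\<close>

record ('k, 'i, 'a, 'o, 'm) kcat_diagram =
  dobj :: "'i \<Rightarrow> ('k, 'o, 'm) kcat"
  dmor :: "'i \<Rightarrow> 'i \<Rightarrow> 'a \<Rightarrow> ('o, 'm, 'o, 'm) fdata"

locale kcat_valued_functor = index: category I
  for K :: "'k ring" and I :: "('i, 'a) cat" and X :: "('k, 'i, 'a, 'o, 'm) kcat_diagram" +
  assumes dobj_k_category: "i \<in> cobj I \<Longrightarrow> k_category K (dobj X i)"
    and dmor_k_functor: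
      "\<lbrakk>i \<in> cobj I; j \<in> cobj I; a \<in> chom I i j\<rbrakk>
        \<Longrightarrow> k_functor K (dobj X i) (dobj X j) (dmor X i j a)"
    and dmor_id:
      "i \<in> cobj I \<Longrightarrow> functor_eq (under_cat (dobj X i)) (dmor X i i (cid I i)) functor_id"
    and dmor_comp:
      "\<lbrakk>i \<in> cobj I; j \<in> cobj I; k \<in> cobj I; a \<in> chom I i j; b \<in> chom I j k\<rbrakk>
        \<Longrightarrow> functor_eq (under_cat (dobj X i)) (dmor X i k (ccomp I i j k b a))
          (functor_comp (dmor X j k b) (dmor X i j a))"

text \<open>
  In the composition, the sum over all \<open>(a, b)\<close> with \<open>b \<circ> a = c\<close> is restricted to the
  supports of \<open>f\<close> and \<open>g\<close>: the omitted terms vanish, and \<^const>\<open>finsum\<close> is only meaningful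
  over finite index sets.
\<close>

definition Gr ::
  "('i, 'a) cat \<Rightarrow> ('k, 'i, 'a, 'o, 'm) kcat_diagram \<Rightarrow> ('k, 'i \<times> 'o, 'a \<Rightarrow> 'm) kcat" where
  "Gr I X =
    \<lparr>kobj = (SIGMA i : cobj I. kobj (dobj X i)),
     khom = (\<lambda>(i, x) (j, y).
       direct_sum (chom I i j) (\<lambda>a. khom (dobj X j) (fobj (dmor X i j a) x) y)),
     kid = (\<lambda>(i, x). \<lambda>a\<in>chom I i i.
       if a = cid I i then kid (dobj X i) x
       else \<zero>\<^bsub>khom (dobj X i) (fobj (dmor X i i a) x) x\<^esub>),
     kcomp = (\<lambda>(i, x) (j, y) (k, z) g f. \<lambda>c\<in>chom I i k.
       finsum (khom (dobj X k) (fobj (dmor X i k c) x) z)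
         (\<lambda>(a, b).
           kcomp (dobj X k)
             (fobj (dmor X j k b) (fobj (dmor X i j a) x)) (fobj (dmor X j k b) y) z
             (g b) (fmor (dmor X j k b) (fobj (dmor X i j a) x) y (f a)))
         {(a, b). a \<in> chom I i j \<and> b \<in> chom I j k \<and> c = ccomp I i j k b a \<and>
           f a \<noteq> \<zero>\<^bsub>khom (dobj X j) (fobj (dmor X i j a) x) y\<^esub> \<and>
           g b \<noteq> \<zero>\<^bsub>khom (dobj X k) (fobj (dmor X j k b) y) z\<^esub>})\<rparr>"

definition diagonal :: "('k, 'o, 'm) kcat \<Rightarrow> ('k, 'i, 'a, 'o, 'm) kcat_diagram" where
  "diagonal C = \<lparr>dobj = \<lambda>_. C, dmor = \<lambda>_ _ _. functor_id\<rparr>"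

lemma k_functor_id:
  assumes "k_category K C"
  shows "k_functor K C C functor_id"
proof -
  interpret k_category K C by fact
  show ?thesis
    by (intro k_functor.intro cat_functor.intro cat_functor_axioms.intro k_functor_axioms.intro
        assms cat.category_axioms)
      (simp_all add: functor_id_def)
qed

lemma kcat_valued_functor_diagonal:
  assumes "category I" "k_category K C"
  shows "kcat_valued_functor K I (diagonal C)"
  by (intro kcat_valued_functor.intro kcat_valued_functor_axioms.intro)
    (simp_all add: diagonal_def assms k_functor_id,
      simp_all add: functor_eq_def functor_comp_def functor_id_def)


section \<open>Quivers, relations and presented categories\<close>

text \<open>
  A quiver is a \<^locale>\<open>wf_digraph\<close>. The path \<open>\<alpha>\<^sub>n \<cdots> \<alpha>\<^sub>1\<close> from \<open>i\<close> is represented by the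
  pair \<open>(i, [\<alpha>\<^sub>1, \<dots>, \<alpha>\<^sub>n])\<close> of its source and its arrows in order of traversal, so the
  composite \<open>q p\<close> (first \<open>p\<close>, then \<open>q\<close>) appends the arrows of \<open>q\<close> to those of \<open>p\<close>. The
  source distinguishes the trivial paths \<open>e\<^sub>i = (i, [])\<close>.
\<close>

definition free_category :: "('v, 'e) pre_digraph \<Rightarrow> ('v, 'v \<times> 'e list) cat" where
  "free_category Q =
    \<lparr>cobj = verts Q,
     chom = \<lambda>i j. {(i, p) | p. pre_digraph.awalk Q i p j},
     cid = \<lambda>i. (i, []),
     ccomp = \<lambda>i j k q p. (i, snd p @ snd q)\<rparr>"

definition is_relations :: "('o, 'm) cat \<Rightarrow> ('m \<times> 'm) set \<Rightarrow> bool" where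
  "is_relations C R \<longleftrightarrow> R \<subseteq> (\<Union>i\<in>cobj C. \<Union>j\<in>cobj C. chom C i j \<times> chom C i j)"

definition rel_at :: "('o, 'm) cat \<Rightarrow> ('m \<times> 'm) set \<Rightarrow> 'o \<Rightarrow> 'o \<Rightarrow> ('m \<times> 'm) set" where
  "rel_at C R i j = R \<inter> (chom C i j \<times> chom C i j)"

definition rel_c :: "('o, 'm) cat \<Rightarrow> ('m \<times> 'm) set \<Rightarrow> 'o \<Rightarrow> 'o \<Rightarrow> ('m \<times> 'm) set" where
  "rel_c C R k l =
    {(ccomp C k j l d (ccomp C k i j a c), ccomp C k j l d (ccomp C k i j b c)) | i j a b c d.
      i \<in> cobj C \<and> j \<in> cobj C \<and> c \<in> chom C k i \<and> d \<in> chom C j l \<and> (a, b) \<in> rel_at C R i j}"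

definition rel_sharp :: "('o, 'm) cat \<Rightarrow> ('m \<times> 'm) set \<Rightarrow> 'o \<Rightarrow> 'o \<Rightarrow> ('m \<times> 'm) set" where
  "rel_sharp C R k l = \<Inter>{E. equiv (chom C k l) E \<and> rel_c C R k l \<subseteq> E}"

text \<open>
  The unions below range over representatives; they are single classes because
  \<^const>\<open>rel_sharp\<close> is compatible with composition.
\<close>

definition quotient_cat :: "('o, 'm) cat \<Rightarrow> ('m \<times> 'm) set \<Rightarrow> ('o, 'm set) cat" where
  "quotient_cat C R =
    \<lparr>cobj = cobj C,
     chom = \<lambda>i j. chom C i j // rel_sharp C R i j,
     cid = \<lambda>i. rel_sharp C R i i `` {cid C i},
     ccomp = \<lambda>i j k G F. \<Union>g\<in>G. \<Union>f\<in>F. rel_sharp C R i k `` {ccomp C i j k g f}\<rparr>"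

definition presented_category ::
  "('v, 'e) pre_digraph \<Rightarrow> (('v \<times> 'e list) \<times> ('v \<times> 'e list)) set
    \<Rightarrow> ('v, ('v \<times> 'e list) set) cat" where
  "presented_category Q R = quotient_cat (free_category Q) R"


section \<open>Quiver algebras, ideals and quotients\<close>

text \<open>The element \<open>a \<mu>\<close> of the \<open>A\<close>-linearization of \<open>C\<close>, for \<open>\<mu> : i \<rightarrow> j\<close>.\<close>

definition lin_single ::
  "('k, 'a) module \<Rightarrow> ('o, 'm) cat \<Rightarrow> 'o \<Rightarrow> 'o \<Rightarrow> 'a \<Rightarrow> 'm \<Rightarrow> ('m \<Rightarrow> 'a)" where
  "lin_single A C i j a \<mu> = (\<lambda>\<nu>\<in>chom C i j. if \<nu> = \<mu> then a else \<zero>\<^bsub>A\<^esub>)"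

text \<open>
  The composition is the biadditive extension of \<open>(b \<beta>) (a \<alpha>) = (b a) (\<beta> \<alpha>)\<close>, see
  \<open>linearization_comp_single\<close> below.
\<close>

definition linearization ::
  "('k, 'a) module \<Rightarrow> ('o, 'm) cat \<Rightarrow> ('k, 'o, 'm \<Rightarrow> 'a) kcat" where
  "linearization A C =
    \<lparr>kobj = cobj C,
     khom = \<lambda>i j. direct_sum (chom C i j) (\<lambda>_. A),
     kid = \<lambda>i. lin_single A C i i \<one>\<^bsub>A\<^esub> (cid C i),
     kcomp = \<lambda>i j k g f. \<lambda>\<gamma>\<in>chom C i k.
       finsum A (\<lambda>(\<alpha>, \<beta>). g \<beta> \<otimes>\<^bsub>A\<^esub> f \<alpha>)
         {(\<alpha>, \<beta>). \<alpha> \<in> chom C i j \<and> \<beta> \<in> chom C j k \<and> \<gamma> = ccomp C i j k \<beta> \<alpha> \<and>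
           f \<alpha> \<noteq> \<zero>\<^bsub>A\<^esub> \<and> g \<beta> \<noteq> \<zero>\<^bsub>A\<^esub>}\<rparr>"

lemma linearization_comp_single:
  assumes "k_algebra K A" "a \<in> carrier A" "b \<in> carrier A" "\<alpha> \<in> chom C i j" "\<beta> \<in> chom C j k"
  shows "kcomp (linearization A C) i j k (lin_single A C j k b \<beta>) (lin_single A C i j a \<alpha>)
    = lin_single A C i k (b \<otimes>\<^bsub>A\<^esub> a) (ccomp C i j k \<beta> \<alpha>)"
proof -
  interpret k_algebra K A by fact
  let ?f = "lin_single A C i j a \<alpha>" and ?g = "lin_single A C j k b \<beta>"
  have f: "?f x = (if x = \<alpha> then a else \<zero>\<^bsub>A\<^esub>)" if "x \<in> chom C i j" for x
    using that by (simp add: lin_single_def)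
  have g: "?g y = (if y = \<beta> then b else \<zero>\<^bsub>A\<^esub>)" if "y \<in> chom C j k" for y
    using that by (simp add: lin_single_def)
  have "{(x, y). x \<in> chom C i j \<and> y \<in> chom C j k \<and> z = ccomp C i j k y x \<and>
      ?f x \<noteq> \<zero>\<^bsub>A\<^esub> \<and> ?g y \<noteq> \<zero>\<^bsub>A\<^esub>}
    = (if z = ccomp C i j k \<beta> \<alpha> \<and> a \<noteq> \<zero>\<^bsub>A\<^esub> \<and> b \<noteq> \<zero>\<^bsub>A\<^esub> then {(\<alpha>, \<beta>)} else {})" for z
    using assms(4,5) f g by (fastforce split: if_splits)
  then have "finsum A (\<lambda>(x, y). ?g y \<otimes>\<^bsub>A\<^esub> ?f x)
      {(x, y). x \<in> chom C i j \<and> y \<in> chom C j k \<and> z = ccomp C i j k y x \<and>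
        ?f x \<noteq> \<zero>\<^bsub>A\<^esub> \<and> ?g y \<noteq> \<zero>\<^bsub>A\<^esub>}
    = (if z = ccomp C i j k \<beta> \<alpha> then b \<otimes>\<^bsub>A\<^esub> a else \<zero>\<^bsub>A\<^esub>)" for z
    using assms(2-5) f g by simp
  then show ?thesis
    by (simp add: linearization_def lin_single_def[of A C i k])
qed

definition quiver_algebra ::
  "('k, 'a) module \<Rightarrow> ('v, 'e) pre_digraph \<Rightarrow> ('k, 'v, 'v \<times> 'e list \<Rightarrow> 'a) kcat" where
  "quiver_algebra A Q = linearization A (free_category Q)"

definition k_ideal :: "'k ring \<Rightarrow> ('k, 'o, 'm) kcat \<Rightarrow> ('o \<Rightarrow> 'o \<Rightarrow> 'm set) \<Rightarrow> bool" where
  "k_ideal K C J \<longleftrightarrow>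
    (\<forall>i\<in>kobj C. \<forall>j\<in>kobj C. submodule (J i j) K (khom C i j)) \<and>
    (\<forall>i\<in>kobj C. \<forall>j\<in>kobj C. \<forall>k\<in>kobj C.
      \<forall>u\<in>J i j. \<forall>g\<in>carrier (khom C j k). kcomp C i j k g u \<in> J i k) \<and>
    (\<forall>i\<in>kobj C. \<forall>j\<in>kobj C. \<forall>k\<in>kobj C.
      \<forall>f\<in>carrier (khom C i j). \<forall>u\<in>J j k. kcomp C i j k u f \<in> J i k)"

definition ideal_generated ::
  "'k ring \<Rightarrow> ('k, 'o, 'm) kcat \<Rightarrow> ('o \<Rightarrow> 'o \<Rightarrow> 'm set) \<Rightarrow> 'o \<Rightarrow> 'o \<Rightarrow> 'm set" where
  "ideal_generated K C S i j =
    \<Inter>{J i j | J. k_ideal K C J \<and> (\<forall>i\<in>kobj C. \<forall>j\<in>kobj C. S i j \<subseteq> J i j)}"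

definition relation_ideal ::
  "'k ring \<Rightarrow> ('k, 'a) module \<Rightarrow> ('v, 'e) pre_digraph \<Rightarrow> (('v \<times> 'e list) \<times> ('v \<times> 'e list)) set
    \<Rightarrow> 'v \<Rightarrow> 'v \<Rightarrow> ('v \<times> 'e list \<Rightarrow> 'a) set" where
  "relation_ideal K A Q R =
    ideal_generated K (quiver_algebra A Q)
      (\<lambda>i j. {lin_single A (free_category Q) i j \<one>\<^bsub>A\<^esub> g
               \<ominus>\<^bsub>khom (quiver_algebra A Q) i j\<^esub> lin_single A (free_category Q) i j \<one>\<^bsub>A\<^esub> h
             | g h. (g, h) \<in> rel_at (free_category Q) R i j})"

definition quotient_module :: "('k, 'm) module \<Rightarrow> 'm set \<Rightarrow> ('k, 'm set) module" where
  "quotient_module M N =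
    \<lparr>carrier = a_rcosets\<^bsub>M\<^esub> N,
     mult = undefined,
     one = undefined,
     zero = N,
     add = (\<lambda>X Y. X <+>\<^bsub>M\<^esub> Y),
     smult = (\<lambda>r X. \<Union>x\<in>X. N +>\<^bsub>M\<^esub> (r \<odot>\<^bsub>M\<^esub> x))\<rparr>"

definition quotient_kcat ::
  "('k, 'o, 'm) kcat \<Rightarrow> ('o \<Rightarrow> 'o \<Rightarrow> 'm set) \<Rightarrow> ('k, 'o, 'm set) kcat" where
  "quotient_kcat C J =
    \<lparr>kobj = kobj C,
     khom = \<lambda>i j. quotient_module (khom C i j) (J i j),
     kid = \<lambda>i. J i i +>\<^bsub>khom C i i\<^esub> kid C i,
     kcomp = \<lambda>i j k G F. \<Union>g\<in>G. \<Union>f\<in>F. J i k +>\<^bsub>khom C i k\<^esub> kcomp C i j k g f\<rparr>"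

end

theory Submission
  imports Defs
begin

text \<open>
  Both sides are descriptions of the \<open>A\<close>-linearization of \<open>I = \<langle>Q | R\<rangle>\<close>.

  On one side, a morphism of the Grothendieck construction of \<open>\<Delta>(A)\<close> is a finitely supported
  family of elements of \<open>A\<close> indexed by morphisms of \<open>I\<close>, and since all transition functors are
  identities such families compose by convolution. This is the linearization of \<open>I\<close>, up to the
  renaming of an object \<open>i\<close> to \<open>(i, *)\<close> (\<open>k_isomorphic_Gr_diagonal\<close>).

  The other side is an instance of a fact about relations \<open>R\<close> of any category \<open>C\<close>:
  the linearization of \<open>C/R\<^sup>#\<close> is the quotient of the linearization of \<open>C\<close> by the ideal
  generated by all \<open>g - h\<close> with \<open>(g, h) \<in> R\<close> (\<open>linearization_quotient_cat\<close>). The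
  projection of \<open>C\<close> onto \<open>C/R\<^sup>#\<close> induces a \<open>K\<close>-functor of linearizations that is the identity on
  objects and onto on morphisms, and by the first isomorphism theorem
  (\<open>k_isomorphic_quotient_kernel\<close>) only its kernel has to be found. The kernel contains the
  generators. That it is no larger (\<open>ideal_generated_relators\<close>) rests on two observations about a
  \<open>K\<close>-functor \<open>G\<close> on the linearization of \<open>C\<close>, applied to the projections modulo arbitrary ideals
  that contain the generators. If \<open>G\<close> identifies \<open>g\<close> and \<open>h\<close> for all \<open>(g, h) \<in> R\<close>, then it
  identifies all morphisms related by \<open>R\<^sup>#\<close>, because the identified pairs form a congruence
  (\<open>rel_sharp_imp_eq\<close>); and a \<open>G\<close> that identifies these morphisms depends only on the sums of
  coefficients over the classes of \<open>R\<^sup>#\<close>, which vanish on the kernel (\<open>push_eq_imp_eq\<close>).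
\<close>

section \<open>Isomorphisms of \<open>K\<close>-categories\<close>

lemma under_cat_simps [simp]:
  "cobj (under_cat C) = kobj C" "chom (under_cat C) i j = carrier (khom C i j)"
  "cid (under_cat C) = kid C" "ccomp (under_cat C) = kcomp C"
  by (simp_all add: under_cat_def)

context k_category
begin

lemma hom_abelian_group: "\<lbrakk>i \<in> kobj C; j \<in> kobj C\<rbrakk> \<Longrightarrow> abelian_group (khom C i j)"
  using module.axioms(2)[OF hom_module] .

lemma hom_add_closed:
  "\<lbrakk>i \<in> kobj C; j \<in> kobj C; f \<in> carrier (khom C i j); g \<in> carrier (khom C i j)\<rbrakk>
    \<Longrightarrow> f \<oplus>\<^bsub>khom C i j\<^esub> g \<in> carrier (khom C i j)"
  using abelian_groupE(1)[OF hom_abelian_group] .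

lemma hom_smult_closed:
  "\<lbrakk>i \<in> kobj C; j \<in> kobj C; r \<in> carrier K; f \<in> carrier (khom C i j)\<rbrakk>
    \<Longrightarrow> r \<odot>\<^bsub>khom C i j\<^esub> f \<in> carrier (khom C i j)"
  using module.smult_closed[OF hom_module] .

end

lemma module_image:
  assumes M: "Module.module K M"
    and img: "h ` carrier M = carrier N"
    and zero: "h \<zero>\<^bsub>M\<^esub> = \<zero>\<^bsub>N\<^esub>"
    and add: "\<And>x y. \<lbrakk>x \<in> carrier M; y \<in> carrier M\<rbrakk> \<Longrightarrow> h (x \<oplus>\<^bsub>M\<^esub> y) = h x \<oplus>\<^bsub>N\<^esub> h y"
    and smult: "\<And>r x. \<lbrakk>r \<in> carrier K; x \<in> carrier M\<rbrakk> \<Longrightarrow> h (r \<odot>\<^bsub>M\<^esub> x) = r \<odot>\<^bsub>N\<^esub> h x"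
  shows "Module.module K N"
proof -
  interpret M: Module.module K M by fact
  note ops = img[symmetric] zero[symmetric] add[symmetric] smult[symmetric]
  have "abelian_group N"
  proof (rule abelian_groupI)
    fix x assume "x \<in> carrier N"
    then obtain m where m: "m \<in> carrier M" "x = h m" by (auto simp: img[symmetric])
    then show "\<exists>y\<in>carrier N. y \<oplus>\<^bsub>N\<^esub> x = \<zero>\<^bsub>N\<^esub>"
      by (intro bexI[of _ "h (\<ominus>\<^bsub>M\<^esub> m)"]) (simp_all add: ops M.l_neg)
  next
    fix x y assume "x \<in> carrier N" "y \<in> carrier N"
    then show "x \<oplus>\<^bsub>N\<^esub> y = y \<oplus>\<^bsub>N\<^esub> x"
      by (auto simp: ops M.M.a_comm)
  qed (auto simp: ops M.M.a_assoc)
  then show ?thesis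
    by (intro moduleI M.R.cring_axioms)
      (auto simp: ops M.smult_l_distr M.smult_r_distr M.smult_assoc1)
qed

lemma k_functorI:
  assumes C: "k_category K C" and D: "k_category K D"
    and "\<And>i. i \<in> kobj C \<Longrightarrow> fobj F i \<in> kobj D"
    and "\<And>i j f. \<lbrakk>i \<in> kobj C; j \<in> kobj C; f \<in> carrier (khom C i j)\<rbrakk>
        \<Longrightarrow> fmor F i j f \<in> carrier (khom D (fobj F i) (fobj F j))"
    and "\<And>i. i \<in> kobj C \<Longrightarrow> fmor F i i (kid C i) = kid D (fobj F i)"
    and "\<And>i j k f g. \<lbrakk>i \<in> kobj C; j \<in> kobj C; k \<in> kobj C;
          f \<in> carrier (khom C i j); g \<in> carrier (khom C j k)\<rbrakk>
        \<Longrightarrow> fmor F i k (kcomp C i j k g f)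
          = kcomp D (fobj F i) (fobj F j) (fobj F k) (fmor F j k g) (fmor F i j f)"
    and "\<And>i j f g. \<lbrakk>i \<in> kobj C; j \<in> kobj C; f \<in> carrier (khom C i j); g \<in> carrier (khom C i j)\<rbrakk>
        \<Longrightarrow> fmor F i j (f \<oplus>\<^bsub>khom C i j\<^esub> g)
          = fmor F i j f \<oplus>\<^bsub>khom D (fobj F i) (fobj F j)\<^esub> fmor F i j g"
    and "\<And>i j r f. \<lbrakk>i \<in> kobj C; j \<in> kobj C; r \<in> carrier K; f \<in> carrier (khom C i j)\<rbrakk>
        \<Longrightarrow> fmor F i j (r \<odot>\<^bsub>khom C i j\<^esub> f)
          = r \<odot>\<^bsub>khom D (fobj F i) (fobj F j)\<^esub> fmor F i j f"
  shows "k_functor K C D F"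
  using assms(3-) k_category.axioms(2)[OF C] k_category.axioms(2)[OF D]
  by (intro k_functor.intro cat_functor.intro cat_functor_axioms.intro k_functor_axioms.intro C D)
    simp_all

text \<open>
  All axioms of a \<open>K\<close>-category are equations between composites, sums and multiples of
  morphisms, and so they pass to any structure on which a map that respects these operations
  is surjective.
\<close>

lemma k_functor_onto:
  assumes C: "k_category K C"
    and obj: "fobj F ` kobj C = kobj D"
    and hom: "\<And>i j. \<lbrakk>i \<in> kobj C; j \<in> kobj C\<rbrakk>
        \<Longrightarrow> fmor F i j ` carrier (khom C i j) = carrier (khom D (fobj F i) (fobj F j))"
    and id: "\<And>i. i \<in> kobj C \<Longrightarrow> fmor F i i (kid C i) = kid D (fobj F i)"
    and comp: "\<And>i j k f g. \<lbrakk>i \<in> kobj C; j \<in> kobj C; k \<in> kobj C;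
          f \<in> carrier (khom C i j); g \<in> carrier (khom C j k)\<rbrakk>
        \<Longrightarrow> fmor F i k (kcomp C i j k g f)
          = kcomp D (fobj F i) (fobj F j) (fobj F k) (fmor F j k g) (fmor F i j f)"
    and zero: "\<And>i j. \<lbrakk>i \<in> kobj C; j \<in> kobj C\<rbrakk>
        \<Longrightarrow> fmor F i j \<zero>\<^bsub>khom C i j\<^esub> = \<zero>\<^bsub>khom D (fobj F i) (fobj F j)\<^esub>"
    and add: "\<And>i j f g. \<lbrakk>i \<in> kobj C; j \<in> kobj C;
          f \<in> carrier (khom C i j); g \<in> carrier (khom C i j)\<rbrakk>
        \<Longrightarrow> fmor F i j (f \<oplus>\<^bsub>khom C i j\<^esub> g)
          = fmor F i j f \<oplus>\<^bsub>khom D (fobj F i) (fobj F j)\<^esub> fmor F i j g"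
    and smult: "\<And>i j r f. \<lbrakk>i \<in> kobj C; j \<in> kobj C; r \<in> carrier K; f \<in> carrier (khom C i j)\<rbrakk>
        \<Longrightarrow> fmor F i j (r \<odot>\<^bsub>khom C i j\<^esub> f)
          = r \<odot>\<^bsub>khom D (fobj F i) (fobj F j)\<^esub> fmor F i j f"
  shows "k_functor K C D F"
proof -
  interpret C: k_category K C by fact
  have hom_mem: "fmor F i j f \<in> carrier (khom D (fobj F i) (fobj F j))"
    if "i \<in> kobj C" "j \<in> kobj C" "f \<in> carrier (khom C i j)" for i j f
    using hom[of i j] that by blast
  have mod: "Module.module K (khom C i j)" if "i \<in> kobj C" "j \<in> kobj C" for i j
    using C.hom_module that .
  note ops = obj[symmetric] hom[symmetric] id[symmetric] comp[symmetric] add[symmetric]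
    smult[symmetric] C.id_closed[simplified] C.comp_closed[simplified]
    C.hom_add_closed C.hom_smult_closed
  have "k_category K D"
  proof (intro k_category.intro k_category_axioms.intro category.intro C.K.cring_axioms)
    fix x y assume "x \<in> kobj D" "y \<in> kobj D"
    then obtain i j where ij: "i \<in> kobj C" "j \<in> kobj C" "x = fobj F i" "y = fobj F j"
      by (auto simp: obj[symmetric])
    show "Module.module K (khom D x y)"
      unfolding ij by (rule module_image[OF mod hom zero add smult]) (use ij in auto)
  qed (auto simp: ops C.id_left[simplified] C.id_right[simplified] C.comp_assoc[simplified]
      C.comp_add_left C.comp_add_right C.comp_smult_left C.comp_smult_right)
  then show ?thesis
    using C obj hom_mem id comp add smult by (intro k_functorI) auto
qed

lemma k_isomorphicI:
  assumes F: "k_functor K C D F"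
    and obj: "bij_betw (fobj F) (kobj C) (kobj D)"
    and hom: "\<And>i j. \<lbrakk>i \<in> kobj C; j \<in> kobj C\<rbrakk> \<Longrightarrow>
        bij_betw (fmor F i j) (carrier (khom C i j)) (carrier (khom D (fobj F i) (fobj F j)))"
  shows "k_isomorphic K C D"
proof -
  interpret F: k_functor K C D F by fact
  define G where "G = \<lparr>fobj = inv_into (kobj C) (fobj F),
    fmor = \<lambda>x y. inv_into
      (carrier (khom C (inv_into (kobj C) (fobj F) x) (inv_into (kobj C) (fobj F) y)))
      (fmor F (inv_into (kobj C) (fobj F) x) (inv_into (kobj C) (fobj F) y))\<rparr>"
  have G_obj: "fobj G (fobj F i) = i" if "i \<in> kobj C" for i
    using bij_betw_inv_into_left[OF obj that] by (simp add: G_def)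
  have G_mor: "fmor G (fobj F i) (fobj F j) (fmor F i j f) = f"
    if "i \<in> kobj C" "j \<in> kobj C" "f \<in> carrier (khom C i j)" for i j f
    using bij_betw_inv_into_left[OF hom] bij_betw_inv_into_left[OF obj] that by (simp add: G_def)
  have obj_eq: "kobj D = fobj F ` kobj C"
    using obj by (simp add: bij_betw_def)
  have hom_eq: "carrier (khom D (fobj F i) (fobj F j)) = fmor F i j ` carrier (khom C i j)"
    if "i \<in> kobj C" "j \<in> kobj C" for i j
    using hom that by (simp add: bij_betw_def)
  note ops = obj_eq hom_eq G_obj G_mor F.mor_id[simplified, symmetric]
    F.mor_comp[simplified, symmetric] F.mor_add[symmetric] F.mor_smult[symmetric]
    F.source.id_closed[simplified] F.source.comp_closed[simplified]
    F.source.hom_add_closed F.source.hom_smult_closed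
  have "k_functor K D C G"
    by (intro k_functorI F.source.k_category_axioms F.target.k_category_axioms)
      (auto simp: ops)
  then show ?thesis
    unfolding k_isomorphic_def functor_eq_def functor_comp_def functor_id_def
    using F by (intro exI[of _ F] exI[of _ G]) (auto simp: ops)
qed

lemma k_isomorphic_sym: "k_isomorphic K C D \<Longrightarrow> k_isomorphic K D C"
  unfolding k_isomorphic_def by blast

lemma k_functor_comp:
  assumes "k_functor K C D F" "k_functor K D E G"
  shows "k_functor K C E (functor_comp G F)"
proof -
  interpret F: k_functor K C D F by fact
  interpret G: k_functor K D E G by fact
  show ?thesis
    by (intro k_functorI F.source.k_category_axioms G.target.k_category_axioms)
      (simp_all add: functor_comp_def F.obj_closed[simplified] G.obj_closed[simplified]
        F.mor_closed[simplified] G.mor_closed[simplified] F.mor_id[simplified]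
        G.mor_id[simplified] F.mor_comp[simplified] G.mor_comp[simplified]
        F.mor_add G.mor_add F.mor_smult G.mor_smult)
qed

lemma k_isomorphic_trans:
  assumes "k_isomorphic K C D" "k_isomorphic K D E"
  shows "k_isomorphic K C E"
proof -
  obtain F F' where F: "k_functor K C D F" "k_functor K D C F'"
      "functor_eq (under_cat C) (functor_comp F' F) functor_id"
      "functor_eq (under_cat D) (functor_comp F F') functor_id"
    using assms(1) by (auto simp: k_isomorphic_def)
  obtain G G' where G: "k_functor K D E G" "k_functor K E D G'"
      "functor_eq (under_cat D) (functor_comp G' G) functor_id"
      "functor_eq (under_cat E) (functor_comp G G') functor_id"
    using assms(2) by (auto simp: k_isomorphic_def)
  interpret F: k_functor K C D F by fact
  interpret G': k_functor K E D G' by fact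
  have "functor_eq (under_cat C) (functor_comp (functor_comp F' G') (functor_comp G F)) functor_id"
    using F(3) G(3) F.obj_closed F.mor_closed
    by (simp add: functor_eq_def functor_comp_def functor_id_def)
  moreover have
    "functor_eq (under_cat E) (functor_comp (functor_comp G F) (functor_comp F' G')) functor_id"
    using F(4) G(4) G'.obj_closed G'.mor_closed
    by (simp add: functor_eq_def functor_comp_def functor_id_def)
  ultimately show ?thesis
    using k_functor_comp[OF F(1) G(1)] k_functor_comp[OF G(2) F(2)]
    unfolding k_isomorphic_def by blast
qed

section \<open>Quotients by ideals\<close>

lemma (in abelian_group) add_minus_eq_zero_iff:
  assumes "x \<in> carrier G" "y \<in> carrier G"
  shows "x \<oplus> \<ominus> y = \<zero> \<longleftrightarrow> x = y"
proof
  assume "x \<oplus> \<ominus> y = \<zero>"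
  then have "\<ominus> (\<ominus> y) = x"
    using assms by (intro minus_equality) simp_all
  then show "x = y"
    using assms by simp
qed (use assms in \<open>simp add: r_neg\<close>)

context k_category
begin

lemma comp_zero_right:
  assumes "i \<in> kobj C" "j \<in> kobj C" "k \<in> kobj C" "g \<in> carrier (khom C j k)"
  shows "kcomp C i j k g \<zero>\<^bsub>khom C i j\<^esub> = \<zero>\<^bsub>khom C i k\<^esub>"
proof -
  interpret M: Module.module K "khom C i j" using hom_module assms(1,2) .
  interpret N: Module.module K "khom C i k" using hom_module assms(1,3) .
  have "kcomp C i j k g (\<zero>\<^bsub>K\<^esub> \<odot>\<^bsub>khom C i j\<^esub> \<zero>\<^bsub>khom C i j\<^esub>) = \<zero>\<^bsub>khom C i k\<^esub>"
    using comp_smult_right[of i j k "\<zero>\<^bsub>K\<^esub>" "\<zero>\<^bsub>khom C i j\<^esub>" g]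
      comp_closed[of i j k "\<zero>\<^bsub>khom C i j\<^esub>" g] assms by simp
  then show ?thesis
    by simp
qed

lemma comp_zero_left:
  assumes "i \<in> kobj C" "j \<in> kobj C" "k \<in> kobj C" "f \<in> carrier (khom C i j)"
  shows "kcomp C i j k \<zero>\<^bsub>khom C j k\<^esub> f = \<zero>\<^bsub>khom C i k\<^esub>"
proof -
  interpret M: Module.module K "khom C j k" using hom_module assms(2,3) .
  interpret N: Module.module K "khom C i k" using hom_module assms(1,3) .
  have "kcomp C i j k (\<zero>\<^bsub>K\<^esub> \<odot>\<^bsub>khom C j k\<^esub> \<zero>\<^bsub>khom C j k\<^esub>) f = \<zero>\<^bsub>khom C i k\<^esub>"
    using comp_smult_left[of i j k "\<zero>\<^bsub>K\<^esub>" f "\<zero>\<^bsub>khom C j k\<^esub>"]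
      comp_closed[of i j k f "\<zero>\<^bsub>khom C j k\<^esub>"] assms by simp
  then show ?thesis
    by simp
qed

lemma k_ideal_submodule:
  "\<lbrakk>k_ideal K C J; i \<in> kobj C; j \<in> kobj C\<rbrakk> \<Longrightarrow> submodule (J i j) K (khom C i j)"
  by (simp add: k_ideal_def)

lemma k_ideal_abelian_subgroup:
  assumes "k_ideal K C J" "i \<in> kobj C" "j \<in> kobj C"
  shows "abelian_subgroup (J i j) (khom C i j)"
  using k_ideal_submodule[OF assms] hom_abelian_group assms(2,3)
  by (intro abelian_subgroupI3 additive_subgroup.intro) (simp_all add: submodule_def)

end

lemma (in k_functor) mor_abelian_group_hom:
  assumes "i \<in> kobj C" "j \<in> kobj C"
  shows "abelian_group_hom (khom C i j) (khom D (fobj F i) (fobj F j)) (fmor F i j)"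
  using assms mor_closed[of i j] obj_closed mor_add
  by (intro abelian_group_homI source.hom_abelian_group target.hom_abelian_group
      group_hom.intro group_hom_axioms.intro abelian_group.a_group) (auto simp: hom_def)

lemma (in k_functor) k_ideal_kernel:
  assumes J: "\<And>i j. \<lbrakk>i \<in> kobj C; j \<in> kobj C\<rbrakk> \<Longrightarrow>
    J i j = {f \<in> carrier (khom C i j). fmor F i j f = \<zero>\<^bsub>khom D (fobj F i) (fobj F j)\<^esub>}"
  shows "k_ideal K C J"
  unfolding k_ideal_def
proof (intro conjI ballI)
  fix i j assume ij: "i \<in> kobj C" "j \<in> kobj C"
  interpret M: Module.module K "khom C i j" using source.hom_module ij .
  interpret N: Module.module K "khom D (fobj F i) (fobj F j)"
    using target.hom_module obj_closed ij by simp
  interpret F: abelian_group_hom "khom C i j" "khom D (fobj F i) (fobj F j)" "fmor F i j"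
    using mor_abelian_group_hom ij .
  show "submodule (J i j) K (khom C i j)"
    by (intro M.submoduleI) (auto simp: J[OF ij] mor_smult[OF ij])
next
  fix i j k u g
  assume ijk: "i \<in> kobj C" "j \<in> kobj C" "k \<in> kobj C"
    and u: "u \<in> J i j" and g: "g \<in> carrier (khom C j k)"
  then show "kcomp C i j k g u \<in> J i k"
    using source.comp_closed[of i j k u g] mor_comp[of i j k u g] obj_closed mor_closed[of j k g]
      target.comp_zero_right[of "fobj F i" "fobj F j" "fobj F k" "fmor F j k g"]
    by (simp add: J)
next
  fix i j k u f
  assume ijk: "i \<in> kobj C" "j \<in> kobj C" "k \<in> kobj C"
    and f: "f \<in> carrier (khom C i j)" and u: "u \<in> J j k"
  then show "kcomp C i j k u f \<in> J i k"
    using source.comp_closed[of i j k f u] mor_comp[of i j k f u] obj_closed mor_closed[of i j f]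
      target.comp_zero_left[of "fobj F i" "fobj F j" "fobj F k" "fmor F i j f"]
    by (simp add: J)
qed

definition quotient_functor ::
  "('k, 'o, 'm) kcat \<Rightarrow> ('o \<Rightarrow> 'o \<Rightarrow> 'm set) \<Rightarrow> ('o, 'm, 'o, 'm set) fdata" where
  "quotient_functor C J = \<lparr>fobj = \<lambda>i. i, fmor = \<lambda>i j f. J i j +>\<^bsub>khom C i j\<^esub> f\<rparr>"

lemma k_functor_quotient:
  assumes C: "k_category K C" and J: "k_ideal K C J"
  shows "k_functor K C (quotient_kcat C J) (quotient_functor C J)"
proof (rule k_functor_onto[OF C])
  interpret C: k_category K C by fact
  fix i j assume ij: "i \<in> kobj C" "j \<in> kobj C"
  interpret J: abelian_subgroup "J i j" "khom C i j"
    using C.k_ideal_abelian_subgroup[OF J ij] .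
  show "fmor (quotient_functor C J) i j ` carrier (khom C i j)
    = carrier (khom (quotient_kcat C J) (fobj (quotient_functor C J) i) (fobj (quotient_functor C J) j))"
    by (auto simp: quotient_functor_def quotient_kcat_def quotient_module_def A_RCOSETS_def')
  show "fmor (quotient_functor C J) i j \<zero>\<^bsub>khom C i j\<^esub>
    = \<zero>\<^bsub>khom (quotient_kcat C J) (fobj (quotient_functor C J) i) (fobj (quotient_functor C J) j)\<^esub>"
    using J.a_subset by (simp add: quotient_functor_def quotient_kcat_def quotient_module_def)
  show "fmor (quotient_functor C J) i j (f \<oplus>\<^bsub>khom C i j\<^esub> g)
      = fmor (quotient_functor C J) i j f
        \<oplus>\<^bsub>khom (quotient_kcat C J) (fobj (quotient_functor C J) i) (fobj (quotient_functor C J) j)\<^esub>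
          fmor (quotient_functor C J) i j g"
    if "f \<in> carrier (khom C i j)" "g \<in> carrier (khom C i j)" for f g
    using that
    by (simp add: quotient_functor_def quotient_kcat_def quotient_module_def J.a_rcos_sum)
  show "fmor (quotient_functor C J) i j (r \<odot>\<^bsub>khom C i j\<^esub> f)
      = r \<odot>\<^bsub>khom (quotient_kcat C J) (fobj (quotient_functor C J) i) (fobj (quotient_functor C J) j)\<^esub>
          fmor (quotient_functor C J) i j f"
    if r: "r \<in> carrier K" and f: "f \<in> carrier (khom C i j)" for r f
  proof -
    interpret M: Module.module K "khom C i j" using C.hom_module ij .
    have "J i j +>\<^bsub>khom C i j\<^esub> (r \<odot>\<^bsub>khom C i j\<^esub> x) = J i j +>\<^bsub>khom C i j\<^esub> (r \<odot>\<^bsub>khom C i j\<^esub> f)"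
      if x: "x \<in> J i j +>\<^bsub>khom C i j\<^esub> f" for x
    proof -
      obtain h where h: "h \<in> J i j" "x = h \<oplus>\<^bsub>khom C i j\<^esub> f"
        using x by (auto simp: a_r_coset_def')
      have "r \<odot>\<^bsub>khom C i j\<^esub> h \<in> J i j"
        using submodule.smult_closed[OF C.k_ideal_submodule[OF J ij] r h(1)] .
      moreover have "r \<odot>\<^bsub>khom C i j\<^esub> x = r \<odot>\<^bsub>khom C i j\<^esub> h \<oplus>\<^bsub>khom C i j\<^esub> r \<odot>\<^bsub>khom C i j\<^esub> f"
        using h r f by (simp add: M.smult_r_distr)
      ultimately have "r \<odot>\<^bsub>khom C i j\<^esub> x \<in> J i j +>\<^bsub>khom C i j\<^esub> (r \<odot>\<^bsub>khom C i j\<^esub> f)"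
        by (auto simp: a_r_coset_def')
      then show ?thesis
        using J.a_repr_independence' r f by simp
    qed
    moreover have "J i j +>\<^bsub>khom C i j\<^esub> f \<noteq> {}"
      using J.a_rcos_self[OF f] by blast
    ultimately show ?thesis
      by (simp add: quotient_functor_def quotient_kcat_def quotient_module_def)
  qed
next
  interpret C: k_category K C by fact
  fix i j k f g
  assume ijk: "i \<in> kobj C" "j \<in> kobj C" "k \<in> kobj C"
    and f: "f \<in> carrier (khom C i j)" and g: "g \<in> carrier (khom C j k)"
  interpret ij: abelian_subgroup "J i j" "khom C i j"
    using C.k_ideal_abelian_subgroup[OF J ijk(1,2)] .
  interpret jk: abelian_subgroup "J j k" "khom C j k"
    using C.k_ideal_abelian_subgroup[OF J ijk(2,3)] .
  interpret ik: abelian_subgroup "J i k" "khom C i k"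
    using C.k_ideal_abelian_subgroup[OF J ijk(1,3)] .
  have gf: "kcomp C i j k g f \<in> carrier (khom C i k)"
    using C.comp_closed[of i j k f g] ijk f g by simp
  have "J i k +>\<^bsub>khom C i k\<^esub> kcomp C i j k y x = J i k +>\<^bsub>khom C i k\<^esub> kcomp C i j k g f"
    if x: "x \<in> J i j +>\<^bsub>khom C i j\<^esub> f" and y: "y \<in> J j k +>\<^bsub>khom C j k\<^esub> g" for x y
  proof -
    obtain u where u: "u \<in> J i j" "x = u \<oplus>\<^bsub>khom C i j\<^esub> f"
      using x by (auto simp: a_r_coset_def')
    obtain v where v: "v \<in> J j k" "y = v \<oplus>\<^bsub>khom C j k\<^esub> g"
      using y by (auto simp: a_r_coset_def')
    have x_closed: "x \<in> carrier (khom C i j)"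
      using u f by simp
    have vx: "kcomp C i j k v x \<in> J i k" and gu: "kcomp C i j k g u \<in> J i k"
      using J ijk u(1) v(1) x_closed g by (auto simp: k_ideal_def)
    have "kcomp C i j k y x = kcomp C i j k v x \<oplus>\<^bsub>khom C i k\<^esub> kcomp C i j k g x"
      using ijk v g x_closed by (simp add: C.comp_add_left)
    also have "kcomp C i j k g x = kcomp C i j k g u \<oplus>\<^bsub>khom C i k\<^esub> kcomp C i j k g f"
      using ijk u f g by (simp add: C.comp_add_right)
    finally have "kcomp C i j k y x
        = (kcomp C i j k v x \<oplus>\<^bsub>khom C i k\<^esub> kcomp C i j k g u) \<oplus>\<^bsub>khom C i k\<^esub> kcomp C i j k g f"
      using vx gu gf by (simp add: ik.a_assoc)
    then have "kcomp C i j k y x \<in> J i k +>\<^bsub>khom C i k\<^esub> kcomp C i j k g f"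
      using vx gu by (auto simp: a_r_coset_def')
    then show ?thesis
      using ik.a_repr_independence' gf by simp
  qed
  moreover have "J i j +>\<^bsub>khom C i j\<^esub> f \<noteq> {}" "J j k +>\<^bsub>khom C j k\<^esub> g \<noteq> {}"
    using ij.a_rcos_self[OF f] jk.a_rcos_self[OF g] by blast+
  ultimately show "fmor (quotient_functor C J) i k (kcomp C i j k g f)
    = kcomp (quotient_kcat C J) (fobj (quotient_functor C J) i) (fobj (quotient_functor C J) j)
        (fobj (quotient_functor C J) k) (fmor (quotient_functor C J) j k g)
        (fmor (quotient_functor C J) i j f)"
    by (simp add: quotient_functor_def quotient_kcat_def)
qed (simp_all add: quotient_functor_def quotient_kcat_def)

lemma (in k_category) quotient_functor_eq_iff:
  assumes J: "k_ideal K C J" and ij: "i \<in> kobj C" "j \<in> kobj C"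
    and f: "f \<in> carrier (khom C i j)" and g: "g \<in> carrier (khom C i j)"
  shows "fmor (quotient_functor C J) i j f = fmor (quotient_functor C J) i j g
    \<longleftrightarrow> f \<ominus>\<^bsub>khom C i j\<^esub> g \<in> J i j"
proof -
  interpret J: abelian_subgroup "J i j" "khom C i j"
    using k_ideal_abelian_subgroup[OF J ij] .
  have "f \<ominus>\<^bsub>khom C i j\<^esub> g \<in> J i j \<longleftrightarrow> f \<in> J i j +>\<^bsub>khom C i j\<^esub> g"
    using J.a_rcos_module[OF g f] by (simp add: a_minus_def)
  also have "\<dots> \<longleftrightarrow> J i j +>\<^bsub>khom C i j\<^esub> f = J i j +>\<^bsub>khom C i j\<^esub> g"
    using J.a_repr_independence'[OF _ g] J.a_rcos_self[OF f] by metis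
  finally show ?thesis
    by (simp add: quotient_functor_def)
qed

text \<open>
  The first isomorphism theorem for \<open>K\<close>-categories: two morphisms have the same coset modulo
  the kernel of \<open>F\<close> exactly when \<open>F\<close> identifies them, so \<open>F\<close> factors through a faithful
  functor on the quotient.
\<close>

theorem k_isomorphic_quotient_kernel:
  assumes F: "k_functor K C D F"
    and obj: "bij_betw (fobj F) (kobj C) (kobj D)"
    and full: "\<And>i j. \<lbrakk>i \<in> kobj C; j \<in> kobj C\<rbrakk> \<Longrightarrow>
        fmor F i j ` carrier (khom C i j) = carrier (khom D (fobj F i) (fobj F j))"
    and J: "\<And>i j. \<lbrakk>i \<in> kobj C; j \<in> kobj C\<rbrakk> \<Longrightarrow>
        J i j = {f \<in> carrier (khom C i j). fmor F i j f = \<zero>\<^bsub>khom D (fobj F i) (fobj F j)\<^esub>}"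
  shows "k_isomorphic K (quotient_kcat C J) D"
proof -
  interpret F: k_functor K C D F by fact
  let ?E = "quotient_kcat C J" and ?q = "quotient_functor C J"
  have ideal: "k_ideal K C J"
    using J by (rule F.k_ideal_kernel)
  interpret q: k_functor K C ?E ?q
    by (intro k_functor_quotient F.source.k_category_axioms ideal)
  have q_obj: "fobj ?q i = i" and E_obj: "kobj ?E = kobj C" for i
    by (simp_all add: quotient_functor_def quotient_kcat_def)
  have E_hom: "carrier (khom ?E i j) = fmor ?q i j ` carrier (khom C i j)" for i j
    by (auto simp: quotient_functor_def quotient_kcat_def quotient_module_def A_RCOSETS_def')
  have q_eq_iff: "fmor ?q i j f = fmor ?q i j g \<longleftrightarrow> fmor F i j f = fmor F i j g"
    and q_elem: "fmor F i j ` fmor ?q i j f = {fmor F i j f}"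
    if ij: "i \<in> kobj C" "j \<in> kobj C" and f: "f \<in> carrier (khom C i j)"
      and g: "g \<in> carrier (khom C i j)" for i j f g
  proof -
    interpret J: abelian_subgroup "J i j" "khom C i j"
      using F.source.k_ideal_abelian_subgroup[OF ideal ij] .
    interpret h: abelian_group_hom "khom C i j" "khom D (fobj F i) (fobj F j)" "fmor F i j"
      using F.mor_abelian_group_hom ij .
    have mem: "x \<in> fmor ?q i j f \<longleftrightarrow> x \<in> carrier (khom C i j) \<and> fmor F i j x = fmor F i j f"
      if f: "f \<in> carrier (khom C i j)" for x f
    proof (cases "x \<in> carrier (khom C i j)")
      case True
      have "x \<in> fmor ?q i j f \<longleftrightarrow> x \<oplus>\<^bsub>khom C i j\<^esub> \<ominus>\<^bsub>khom C i j\<^esub> f \<in> J i j"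
        using J.a_rcos_module[OF f True] by (simp add: quotient_functor_def)
      also have "\<dots> \<longleftrightarrow> fmor F i j (x \<oplus>\<^bsub>khom C i j\<^esub> \<ominus>\<^bsub>khom C i j\<^esub> f)
          = \<zero>\<^bsub>khom D (fobj F i) (fobj F j)\<^esub>"
        unfolding J[OF ij] using True f by simp
      also have "fmor F i j (x \<oplus>\<^bsub>khom C i j\<^esub> \<ominus>\<^bsub>khom C i j\<^esub> f)
          = fmor F i j x \<oplus>\<^bsub>khom D (fobj F i) (fobj F j)\<^esub>
              \<ominus>\<^bsub>khom D (fobj F i) (fobj F j)\<^esub> fmor F i j f"
        using True f by simp
      also have "fmor F i j x \<oplus>\<^bsub>khom D (fobj F i) (fobj F j)\<^esub>
            \<ominus>\<^bsub>khom D (fobj F i) (fobj F j)\<^esub> fmor F i j f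
              = \<zero>\<^bsub>khom D (fobj F i) (fobj F j)\<^esub>
          \<longleftrightarrow> fmor F i j x = fmor F i j f"
        using True f by (intro h.H.add_minus_eq_zero_iff) simp_all
      finally show ?thesis
        using True by simp
    next
      case False
      then show ?thesis
        using J.a_elemrcos_carrier[OF f] by (auto simp: quotient_functor_def)
    qed
    show "fmor ?q i j f = fmor ?q i j g \<longleftrightarrow> fmor F i j f = fmor F i j g"
      using mem[OF f] mem[OF g] f g by (metis subsetI subset_antisym)
    show "fmor F i j ` fmor ?q i j f = {fmor F i j f}"
      using mem[OF f] f by (auto simp: image_iff)
  qed
  \<comment> \<open>A coset of the kernel is a fibre of \<open>F\<close>, and so its image is a singleton.\<close>
  define G where "G = \<lparr>fobj = fobj F, fmor = \<lambda>i j X. the_elem (fmor F i j ` X)\<rparr>"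
  have G_obj: "fobj G = fobj F"
    by (simp add: G_def)
  have G_mor: "fmor G i j (fmor ?q i j f) = fmor F i j f"
    if "i \<in> kobj C" "j \<in> kobj C" "f \<in> carrier (khom C i j)" for i j f
    using q_elem[OF that that(3)] by (simp add: G_def)
  note ops = E_obj E_hom G_obj G_mor q.mor_id[simplified q_obj, simplified, symmetric]
    q.mor_comp[simplified q_obj, simplified, symmetric] q.mor_add[simplified q_obj, symmetric]
    q.mor_smult[simplified q_obj, symmetric]
    F.source.id_closed[simplified] F.source.comp_closed[simplified]
    F.source.hom_add_closed F.source.hom_smult_closed
  have "k_functor K ?E D G"
    by (intro k_functorI q.target.k_category_axioms F.target.k_category_axioms)
      (auto simp: ops F.obj_closed[simplified] F.mor_closed[simplified] F.mor_id[simplified]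
        F.mor_comp[simplified] F.mor_add F.mor_smult)
  then show ?thesis
  proof (rule k_isomorphicI)
    show "bij_betw (fobj G) (kobj ?E) (kobj D)"
      using obj by (simp add: ops)
    fix i j assume "i \<in> kobj ?E" "j \<in> kobj ?E"
    then have ij: "i \<in> kobj C" "j \<in> kobj C"
      by (simp_all add: E_obj)
    have "inj_on (fmor G i j) (carrier (khom ?E i j))"
      using ij by (auto simp: inj_on_def E_hom G_mor q_eq_iff)
    moreover have "fmor G i j ` carrier (khom ?E i j) = carrier (khom D (fobj G i) (fobj G j))"
      using ij full[OF ij] by (simp add: E_hom image_image G_mor G_obj)
    ultimately show
      "bij_betw (fmor G i j) (carrier (khom ?E i j)) (carrier (khom D (fobj G i) (fobj G j)))"
      by (simp add: bij_betw_def)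
  qed
qed

section \<open>Direct sums and linearizations\<close>

lemma module_direct_sum:
  assumes K: "cring K" and M: "\<And>a. a \<in> S \<Longrightarrow> Module.module K (M a)"
  shows "Module.module K (direct_sum S M)"
proof -
  let ?D = "direct_sum S M"
  have grp: "abelian_group (M a)" if "a \<in> S" for a
    using module.axioms(2)[OF M[OF that]] .
  note zero_mem = abelian_groupE(2)[OF grp] and add_mem = abelian_groupE(1)[OF grp]
    and inv_mem = abelian_group.a_inv_closed[OF grp] and l_zero = abelian_groupE(5)[OF grp]
  have inv_zero: "\<ominus>\<^bsub>M a\<^esub> \<zero>\<^bsub>M a\<^esub> = \<zero>\<^bsub>M a\<^esub>" if "a \<in> S" for a
    using that by (intro abelian_group.minus_equality[OF grp]) (simp_all add: zero_mem l_zero)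
  have mem: "f \<in> carrier ?D \<longleftrightarrow>
      f \<in> extensional S \<and> (\<forall>a\<in>S. f a \<in> carrier (M a)) \<and> finite {a \<in> S. f a \<noteq> \<zero>\<^bsub>M a\<^esub>}" for f
    by (auto simp: direct_sum_def PiE_iff)
  have ext: "f = g" if "f \<in> carrier ?D" "g \<in> carrier ?D" "\<And>a. a \<in> S \<Longrightarrow> f a = g a" for f g
    using that by (intro extensionalityI[of f S g]) (auto simp: mem)
  have apply_mem: "f a \<in> carrier (M a)" if "f \<in> carrier ?D" "a \<in> S" for f a
    using that by (simp add: mem)
  have zero: "\<zero>\<^bsub>?D\<^esub> a = \<zero>\<^bsub>M a\<^esub>" and add: "(f \<oplus>\<^bsub>?D\<^esub> g) a = f a \<oplus>\<^bsub>M a\<^esub> g a"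
    and smult: "(r \<odot>\<^bsub>?D\<^esub> f) a = r \<odot>\<^bsub>M a\<^esub> f a" if "a \<in> S" for f g r a
    using that by (simp_all add: direct_sum_def)
  have zero_closed: "\<zero>\<^bsub>?D\<^esub> \<in> carrier ?D"
  proof -
    have "finite {a \<in> S. \<zero>\<^bsub>?D\<^esub> a \<noteq> \<zero>\<^bsub>M a\<^esub>}"
      by (rule finite_subset[of _ "{}"]) (auto simp: zero)
    moreover have "\<zero>\<^bsub>?D\<^esub> \<in> extensional S"
      by (simp add: direct_sum_def)
    ultimately show ?thesis
      by (simp add: mem zero zero_mem)
  qed
  have add_closed: "f \<oplus>\<^bsub>?D\<^esub> g \<in> carrier ?D" if f: "f \<in> carrier ?D" and g: "g \<in> carrier ?D" for f g
  proof -
    have "finite ({a \<in> S. f a \<noteq> \<zero>\<^bsub>M a\<^esub>} \<union> {a \<in> S. g a \<noteq> \<zero>\<^bsub>M a\<^esub>})"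
      using f g by (simp add: mem)
    then have "finite {a \<in> S. (f \<oplus>\<^bsub>?D\<^esub> g) a \<noteq> \<zero>\<^bsub>M a\<^esub>}"
      by (rule finite_subset[rotated]) (auto simp: add l_zero zero_mem)
    moreover have "f \<oplus>\<^bsub>?D\<^esub> g \<in> extensional S"
      by (simp add: direct_sum_def)
    ultimately show ?thesis
      using f g by (simp add: mem add add_mem)
  qed
  have smult_closed: "r \<odot>\<^bsub>?D\<^esub> f \<in> carrier ?D" if r: "r \<in> carrier K" and f: "f \<in> carrier ?D" for r f
  proof -
    have "finite {a \<in> S. f a \<noteq> \<zero>\<^bsub>M a\<^esub>}"
      using f by (simp add: mem)
    then have "finite {a \<in> S. (r \<odot>\<^bsub>?D\<^esub> f) a \<noteq> \<zero>\<^bsub>M a\<^esub>}"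
      by (rule finite_subset[rotated]) (auto simp: smult module.smult_r_null[OF M r])
    moreover have "r \<odot>\<^bsub>?D\<^esub> f \<in> extensional S"
      by (simp add: direct_sum_def)
    ultimately show ?thesis
      using r f by (simp add: mem smult module.smult_closed[OF M])
  qed
  have "abelian_group ?D"
  proof (rule abelian_groupI)
    fix f assume f: "f \<in> carrier ?D"
    let ?g = "\<lambda>a\<in>S. \<ominus>\<^bsub>M a\<^esub> f a"
    have "finite {a \<in> S. f a \<noteq> \<zero>\<^bsub>M a\<^esub>}"
      using f by (simp add: mem)
    then have "finite {a \<in> S. ?g a \<noteq> \<zero>\<^bsub>M a\<^esub>}"
      by (rule finite_subset[rotated]) (auto simp: inv_zero)
    then have g: "?g \<in> carrier ?D"
      using f by (simp add: mem inv_mem)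
    have "?g \<oplus>\<^bsub>?D\<^esub> f = \<zero>\<^bsub>?D\<^esub>"
      using f by (intro ext add_closed zero_closed g)
        (simp_all add: add zero apply_mem abelian_group.l_neg[OF grp])
    with g show "\<exists>g\<in>carrier ?D. g \<oplus>\<^bsub>?D\<^esub> f = \<zero>\<^bsub>?D\<^esub>"
      by blast
  next
    fix f g assume fg: "f \<in> carrier ?D" "g \<in> carrier ?D"
    show "f \<oplus>\<^bsub>?D\<^esub> g = g \<oplus>\<^bsub>?D\<^esub> f"
      using fg by (intro ext add_closed) (simp_all add: add apply_mem abelian_groupE(4)[OF grp])
    fix h assume h: "h \<in> carrier ?D"
    show "f \<oplus>\<^bsub>?D\<^esub> g \<oplus>\<^bsub>?D\<^esub> h = f \<oplus>\<^bsub>?D\<^esub> (g \<oplus>\<^bsub>?D\<^esub> h)"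
      using fg h by (intro ext add_closed) (simp_all add: add apply_mem abelian_groupE(3)[OF grp])
  next
    fix f assume f: "f \<in> carrier ?D"
    then show "\<zero>\<^bsub>?D\<^esub> \<oplus>\<^bsub>?D\<^esub> f = f"
      by (intro ext add_closed zero_closed) (simp_all add: add zero apply_mem l_zero)
  qed (simp_all add: add_closed zero_closed)
  then show ?thesis
  proof (intro moduleI K)
    fix r s f assume "r \<in> carrier K" "s \<in> carrier K" "f \<in> carrier ?D"
    then show "(r \<oplus>\<^bsub>K\<^esub> s) \<odot>\<^bsub>?D\<^esub> f = r \<odot>\<^bsub>?D\<^esub> f \<oplus>\<^bsub>?D\<^esub> s \<odot>\<^bsub>?D\<^esub> f"
      and "(r \<otimes>\<^bsub>K\<^esub> s) \<odot>\<^bsub>?D\<^esub> f = r \<odot>\<^bsub>?D\<^esub> (s \<odot>\<^bsub>?D\<^esub> f)"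
      using cring.cring_simprules(1,5)[OF K]
      by (auto intro!: ext add_closed smult_closed simp: add smult apply_mem
          module.smult_l_distr[OF M] module.smult_assoc1[OF M])
  next
    fix r f g assume "r \<in> carrier K" "f \<in> carrier ?D" "g \<in> carrier ?D"
    then show "r \<odot>\<^bsub>?D\<^esub> (f \<oplus>\<^bsub>?D\<^esub> g) = r \<odot>\<^bsub>?D\<^esub> f \<oplus>\<^bsub>?D\<^esub> r \<odot>\<^bsub>?D\<^esub> g"
      by (intro ext add_closed smult_closed)
        (simp_all add: add smult apply_mem module.smult_r_distr[OF M])
  next
    fix f assume "f \<in> carrier ?D"
    then show "\<one>\<^bsub>K\<^esub> \<odot>\<^bsub>?D\<^esub> f = f"
      using cring.cring_simprules(6)[OF K]
      by (intro ext smult_closed) (simp_all add: smult apply_mem module.smult_one[OF M])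
  qed (simp_all add: smult_closed)
qed

locale linearized_category = k_algebra K A + cat: category C
  for K :: "'k ring" and A :: "('k, 'a) module" and C :: "('o, 'm) cat"
begin

abbreviation Hom :: "'o \<Rightarrow> 'o \<Rightarrow> ('k, 'm \<Rightarrow> 'a) module" where
  "Hom i j \<equiv> khom (linearization A C) i j"

lemma kobj_linearization [simp]: "kobj (linearization A C) = cobj C"
  by (simp add: linearization_def)

lemma kid_linearization: "kid (linearization A C) i = lin_single A C i i \<one>\<^bsub>A\<^esub> (cid C i)"
  by (simp add: linearization_def)

lemma Hom_module: "Module.module K (Hom i j)"
  by (simp add: linearization_def module_direct_sum R.cring_axioms module_axioms)

lemma Hom_iff: "f \<in> carrier (Hom i j) \<longleftrightarrow> f \<in> extensional (chom C i j) \<and>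
    (\<forall>\<mu>\<in>chom C i j. f \<mu> \<in> carrier A) \<and> finite {\<mu> \<in> chom C i j. f \<mu> \<noteq> \<zero>\<^bsub>A\<^esub>}"
  by (auto simp: linearization_def direct_sum_def PiE_iff)

lemma Hom_apply_closed:
  "\<lbrakk>f \<in> carrier (Hom i j); \<mu> \<in> chom C i j\<rbrakk> \<Longrightarrow> f \<mu> \<in> carrier A"
  by (simp add: Hom_iff)

lemma Hom_finite_support: "f \<in> carrier (Hom i j) \<Longrightarrow> finite {\<mu> \<in> chom C i j. f \<mu> \<noteq> \<zero>\<^bsub>A\<^esub>}"
  by (simp add: Hom_iff)

lemma Hom_eqI:
  assumes "f \<in> carrier (Hom i j)" "g \<in> carrier (Hom i j)"
    and "\<And>\<mu>. \<mu> \<in> chom C i j \<Longrightarrow> f \<mu> = g \<mu>"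
  shows "f = g"
  using assms by (intro extensionalityI[of f "chom C i j" g]) (auto simp: Hom_iff)

lemma Hom_zero_apply: "\<mu> \<in> chom C i j \<Longrightarrow> \<zero>\<^bsub>Hom i j\<^esub> \<mu> = \<zero>\<^bsub>A\<^esub>"
  and Hom_add_apply: "\<mu> \<in> chom C i j \<Longrightarrow> (f \<oplus>\<^bsub>Hom i j\<^esub> g) \<mu> = f \<mu> \<oplus>\<^bsub>A\<^esub> g \<mu>"
  and Hom_smult_apply: "\<mu> \<in> chom C i j \<Longrightarrow> (r \<odot>\<^bsub>Hom i j\<^esub> f) \<mu> = r \<odot>\<^bsub>A\<^esub> f \<mu>"
  by (simp_all add: linearization_def direct_sum_def)

lemma Hom_zero_closed: "\<zero>\<^bsub>Hom i j\<^esub> \<in> carrier (Hom i j)"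
  and Hom_add_closed: "\<lbrakk>f \<in> carrier (Hom i j); g \<in> carrier (Hom i j)\<rbrakk>
    \<Longrightarrow> f \<oplus>\<^bsub>Hom i j\<^esub> g \<in> carrier (Hom i j)"
  and Hom_smult_closed: "\<lbrakk>r \<in> carrier K; f \<in> carrier (Hom i j)\<rbrakk>
    \<Longrightarrow> r \<odot>\<^bsub>Hom i j\<^esub> f \<in> carrier (Hom i j)"
  using module.smult_closed[OF Hom_module] abelian_groupE(1,2)[OF module.axioms(2)[OF Hom_module]]
  by auto

lemma single_apply:
  "\<nu> \<in> chom C i j \<Longrightarrow> lin_single A C i j a \<mu> \<nu> = (if \<nu> = \<mu> then a else \<zero>\<^bsub>A\<^esub>)"
  by (simp add: lin_single_def)

lemma single_closed:
  assumes "a \<in> carrier A"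
  shows "lin_single A C i j a \<mu> \<in> carrier (Hom i j)"
proof -
  have "finite {\<nu> \<in> chom C i j. lin_single A C i j a \<mu> \<nu> \<noteq> \<zero>\<^bsub>A\<^esub>}"
    by (rule finite_subset[of _ "{\<mu>}"]) (auto simp: single_apply split: if_splits)
  then show ?thesis
    using assms by (auto simp: Hom_iff lin_single_def)
qed

text \<open>
  The elements \<open>a \<mu>\<close> generate the morphism modules additively. Identities between biadditive
  operations therefore need to be checked only on them, where composition is explicit.
\<close>

lemma Hom_induct [consumes 1, case_names zero single add]:
  assumes f: "f \<in> carrier (Hom i j)"
    and zero: "P \<zero>\<^bsub>Hom i j\<^esub>"
    and single: "\<And>a \<mu>. \<lbrakk>a \<in> carrier A; \<mu> \<in> chom C i j\<rbrakk> \<Longrightarrow> P (lin_single A C i j a \<mu>)"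
    and add: "\<And>f g. \<lbrakk>f \<in> carrier (Hom i j); g \<in> carrier (Hom i j); P f; P g\<rbrakk>
      \<Longrightarrow> P (f \<oplus>\<^bsub>Hom i j\<^esub> g)"
  shows "P f"
proof -
  have "P f" if "finite S" "f \<in> carrier (Hom i j)" "{\<mu> \<in> chom C i j. f \<mu> \<noteq> \<zero>\<^bsub>A\<^esub>} \<subseteq> S" for S f
    using that
  proof (induction S arbitrary: f)
    case empty
    have "f = \<zero>\<^bsub>Hom i j\<^esub>"
      using empty by (intro Hom_eqI[of f i j] Hom_zero_closed) (auto simp: Hom_zero_apply)
    then show ?case
      using zero by simp
  next
    case (insert \<mu> S)
    show ?case
    proof (cases "\<mu> \<in> chom C i j")
      case True
      let ?g = "f(\<mu> := \<zero>\<^bsub>A\<^esub>)" and ?s = "lin_single A C i j (f \<mu>) \<mu>"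
      have fin: "finite {\<nu> \<in> chom C i j. ?g \<nu> \<noteq> \<zero>\<^bsub>A\<^esub>}"
        by (rule finite_subset[OF _ Hom_finite_support[OF insert.prems(1)]]) auto
      have g: "?g \<in> carrier (Hom i j)"
        using insert.prems(1) True fin by (auto simp: Hom_iff extensional_def)
      have s: "?s \<in> carrier (Hom i j)"
        using Hom_apply_closed[OF insert.prems(1) True] by (rule single_closed)
      have "f = ?s \<oplus>\<^bsub>Hom i j\<^esub> ?g"
        using insert.prems(1) Hom_apply_closed[OF insert.prems(1)]
        by (intro Hom_eqI[of f i j] Hom_add_closed s g) (auto simp: Hom_add_apply single_apply)
      moreover have "P ?g"
        by (rule insert.IH[OF g]) (use insert.prems in auto)
      moreover have "P ?s"
        using single Hom_apply_closed[OF insert.prems(1) True] True by blast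
      ultimately show ?thesis
        using add[OF s g] by simp
    next
      case False
      then show ?thesis
        using insert by auto
    qed
  qed
  from this[OF Hom_finite_support[OF f] f] show ?thesis
    by simp
qed

text \<open>
  Over a finite rectangle that contains both supports, the composite becomes a sum whose index
  set can be shared by several factors; this makes biadditivity a termwise matter.
\<close>

lemma comp_apply:
  assumes f: "f \<in> carrier (Hom i j)" and g: "g \<in> carrier (Hom j k)" and \<gamma>: "\<gamma> \<in> chom C i k"
    and S: "finite S" "{\<alpha> \<in> chom C i j. f \<alpha> \<noteq> \<zero>\<^bsub>A\<^esub>} \<subseteq> S" "S \<subseteq> chom C i j"
    and T: "finite T" "{\<beta> \<in> chom C j k. g \<beta> \<noteq> \<zero>\<^bsub>A\<^esub>} \<subseteq> T" "T \<subseteq> chom C j k"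
  shows "kcomp (linearization A C) i j k g f \<gamma>
    = finsum A (\<lambda>(\<alpha>, \<beta>). if \<gamma> = ccomp C i j k \<beta> \<alpha> then g \<beta> \<otimes>\<^bsub>A\<^esub> f \<alpha> else \<zero>\<^bsub>A\<^esub>) (S \<times> T)"
proof -
  have f_mem: "f \<alpha> \<in> carrier A" if "\<alpha> \<in> S" for \<alpha>
    using that f S(3) by (auto simp: Hom_iff)
  have g_mem: "g \<beta> \<in> carrier A" if "\<beta> \<in> T" for \<beta>
    using that g T(3) by (auto simp: Hom_iff)
  have zero: "g \<beta> \<otimes>\<^bsub>A\<^esub> f \<alpha> = \<zero>\<^bsub>A\<^esub>"
    if "\<alpha> \<in> S" "\<beta> \<in> T" "f \<alpha> = \<zero>\<^bsub>A\<^esub> \<or> g \<beta> = \<zero>\<^bsub>A\<^esub>" for \<alpha> \<beta>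
    using that f_mem g_mem by auto
  have
    "finsum A (\<lambda>(\<alpha>, \<beta>). g \<beta> \<otimes>\<^bsub>A\<^esub> f \<alpha>)
      {(\<alpha>, \<beta>). \<alpha> \<in> chom C i j \<and> \<beta> \<in> chom C j k \<and> \<gamma> = ccomp C i j k \<beta> \<alpha> \<and>
        f \<alpha> \<noteq> \<zero>\<^bsub>A\<^esub> \<and> g \<beta> \<noteq> \<zero>\<^bsub>A\<^esub>}
    = finsum A (\<lambda>(\<alpha>, \<beta>). if \<gamma> = ccomp C i j k \<beta> \<alpha> then g \<beta> \<otimes>\<^bsub>A\<^esub> f \<alpha> else \<zero>\<^bsub>A\<^esub>) (S \<times> T)"
    (is "finsum A ?t ?I = finsum A ?h (S \<times> T)")
  proof (rule M.add.finprod_mono_neutral_cong_left)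
    show "finite (S \<times> T)"
      using S(1) T(1) by simp
    show "?I \<subseteq> S \<times> T"
      using S(2) T(2) by blast
    show "?h p = \<zero>\<^bsub>A\<^esub>" if "p \<in> S \<times> T - ?I" for p
    proof -
      obtain \<alpha> \<beta> where p: "p = (\<alpha>, \<beta>)" "\<alpha> \<in> S" "\<beta> \<in> T"
        using \<open>p \<in> S \<times> T - ?I\<close> by blast
      moreover have "\<alpha> \<in> chom C i j" "\<beta> \<in> chom C j k"
        using p S(3) T(3) by blast+
      ultimately show ?thesis
        using that zero by auto
    qed
    show "?h \<in> S \<times> T \<rightarrow> carrier A"
      using f_mem g_mem by auto
  qed auto
  then show ?thesis
    using \<gamma> by (simp add: linearization_def)
qed

lemma comp_closed:
  assumes ijk: "i \<in> cobj C" "j \<in> cobj C" "k \<in> cobj C"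
    and f: "f \<in> carrier (Hom i j)" and g: "g \<in> carrier (Hom j k)"
  shows "kcomp (linearization A C) i j k g f \<in> carrier (Hom i k)"
proof -
  let ?S = "{\<alpha> \<in> chom C i j. f \<alpha> \<noteq> \<zero>\<^bsub>A\<^esub>}" and ?T = "{\<beta> \<in> chom C j k. g \<beta> \<noteq> \<zero>\<^bsub>A\<^esub>}"
  let ?gf = "kcomp (linearization A C) i j k g f"
  have fin: "finite ?S" "finite ?T"
    using f g by (simp_all add: Hom_finite_support)
  have gf: "?gf \<gamma> = finsum A (\<lambda>(\<alpha>, \<beta>). if \<gamma> = ccomp C i j k \<beta> \<alpha> then g \<beta> \<otimes>\<^bsub>A\<^esub> f \<alpha> else \<zero>\<^bsub>A\<^esub>)
      (?S \<times> ?T)" if "\<gamma> \<in> chom C i k" for \<gamma>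
    using comp_apply[OF f g that fin(1) _ _ fin(2)] by auto
  have "?gf \<gamma> \<in> carrier A" if "\<gamma> \<in> chom C i k" for \<gamma>
    unfolding gf[OF that]
    by (rule M.finsum_closed) (auto simp: Hom_apply_closed[OF f] Hom_apply_closed[OF g])
  moreover have "?gf \<gamma> = \<zero>\<^bsub>A\<^esub>"
    if "\<gamma> \<in> chom C i k" "\<gamma> \<notin> (\<lambda>(\<alpha>, \<beta>). ccomp C i j k \<beta> \<alpha>) ` (?S \<times> ?T)" for \<gamma>
  proof -
    have "?gf \<gamma> = finsum A (\<lambda>_. \<zero>\<^bsub>A\<^esub>) (?S \<times> ?T)"
      unfolding gf[OF that(1)] using that(2) by (intro M.finsum_cong') auto
    then show ?thesis
      by (simp add: M.finsum_zero)
  qed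
  then have "finite {\<gamma> \<in> chom C i k. ?gf \<gamma> \<noteq> \<zero>\<^bsub>A\<^esub>}"
    by (intro finite_subset[OF _ finite_imageI[OF finite_cartesian_product[OF fin]]]) blast
  moreover have "?gf \<in> extensional (chom C i k)"
    by (simp add: linearization_def)
  ultimately show ?thesis
    by (simp add: Hom_iff)
qed

lemma comp_zero_right:
  assumes "i \<in> cobj C" "j \<in> cobj C" "k \<in> cobj C" "g \<in> carrier (Hom j k)"
  shows "kcomp (linearization A C) i j k g \<zero>\<^bsub>Hom i j\<^esub> = \<zero>\<^bsub>Hom i k\<^esub>"
  using assms comp_apply[OF Hom_zero_closed assms(4), of _ i "{}"] Hom_finite_support[OF assms(4)]
  by (intro Hom_eqI[of _ i k] comp_closed Hom_zero_closed) (auto simp: Hom_zero_apply)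

lemma comp_zero_left:
  assumes "i \<in> cobj C" "j \<in> cobj C" "k \<in> cobj C" "f \<in> carrier (Hom i j)"
  shows "kcomp (linearization A C) i j k \<zero>\<^bsub>Hom j k\<^esub> f = \<zero>\<^bsub>Hom i k\<^esub>"
  using assms comp_apply[OF assms(4) Hom_zero_closed, of _ k _ "{}"] Hom_finite_support[OF assms(4)]
  by (intro Hom_eqI[of _ i k] comp_closed Hom_zero_closed) (auto simp: Hom_zero_apply)

lemma comp_add_right:
  assumes ijk: "i \<in> cobj C" "j \<in> cobj C" "k \<in> cobj C"
    and g: "g \<in> carrier (Hom j k)" and f: "f \<in> carrier (Hom i j)" "f' \<in> carrier (Hom i j)"
  shows "kcomp (linearization A C) i j k g (f \<oplus>\<^bsub>Hom i j\<^esub> f')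
    = kcomp (linearization A C) i j k g f \<oplus>\<^bsub>Hom i k\<^esub> kcomp (linearization A C) i j k g f'"
proof (rule Hom_eqI[of _ i k])
  fix \<gamma> assume \<gamma>: "\<gamma> \<in> chom C i k"
  define S where "S = {\<alpha> \<in> chom C i j. f \<alpha> \<noteq> \<zero>\<^bsub>A\<^esub>} \<union> {\<alpha> \<in> chom C i j. f' \<alpha> \<noteq> \<zero>\<^bsub>A\<^esub>}"
  define T where "T = {\<beta> \<in> chom C j k. g \<beta> \<noteq> \<zero>\<^bsub>A\<^esub>}"
  have S: "finite S" "S \<subseteq> chom C i j" and T: "finite T" "T \<subseteq> chom C j k"
    and supp: "{\<alpha> \<in> chom C i j. f \<alpha> \<noteq> \<zero>\<^bsub>A\<^esub>} \<subseteq> S" "{\<alpha> \<in> chom C i j. f' \<alpha> \<noteq> \<zero>\<^bsub>A\<^esub>} \<subseteq> S"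
    using f g Hom_finite_support by (auto simp: S_def T_def)
  have expand: "kcomp (linearization A C) i j k g h \<gamma>
      = finsum A (\<lambda>(\<alpha>, \<beta>). if \<gamma> = ccomp C i j k \<beta> \<alpha> then g \<beta> \<otimes>\<^bsub>A\<^esub> h \<alpha> else \<zero>\<^bsub>A\<^esub>) (S \<times> T)"
    if "h \<in> carrier (Hom i j)" "{\<alpha> \<in> chom C i j. h \<alpha> \<noteq> \<zero>\<^bsub>A\<^esub>} \<subseteq> S" for h
    using comp_apply[OF that(1) g \<gamma> S(1) that(2) S(2) T(1) _ T(2)] by (simp add: T_def)
  have closed: "f \<alpha> \<in> carrier A" "f' \<alpha> \<in> carrier A" "g \<beta> \<in> carrier A"
    if "\<alpha> \<in> S" "\<beta> \<in> T" for \<alpha> \<beta>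
    using that S T f g by (auto simp: Hom_iff)
  have "kcomp (linearization A C) i j k g (f \<oplus>\<^bsub>Hom i j\<^esub> f') \<gamma>
      = finsum A (\<lambda>(\<alpha>, \<beta>). if \<gamma> = ccomp C i j k \<beta> \<alpha>
          then g \<beta> \<otimes>\<^bsub>A\<^esub> (f \<oplus>\<^bsub>Hom i j\<^esub> f') \<alpha> else \<zero>\<^bsub>A\<^esub>) (S \<times> T)"
    using f by (intro expand Hom_add_closed) (auto simp: S_def Hom_add_apply)
  also have "\<dots> = finsum A (\<lambda>x.
      (case x of (\<alpha>, \<beta>) \<Rightarrow> if \<gamma> = ccomp C i j k \<beta> \<alpha> then g \<beta> \<otimes>\<^bsub>A\<^esub> f \<alpha> else \<zero>\<^bsub>A\<^esub>) \<oplus>\<^bsub>A\<^esub>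
      (case x of (\<alpha>, \<beta>) \<Rightarrow> if \<gamma> = ccomp C i j k \<beta> \<alpha> then g \<beta> \<otimes>\<^bsub>A\<^esub> f' \<alpha> else \<zero>\<^bsub>A\<^esub>)) (S \<times> T)"
    using closed S by (intro M.finsum_cong') (auto simp: Hom_add_apply r_distr subset_iff)
  also have "\<dots> = kcomp (linearization A C) i j k g f \<gamma> \<oplus>\<^bsub>A\<^esub> kcomp (linearization A C) i j k g f' \<gamma>"
    using closed f supp by (subst M.finsum_addf) (auto simp: expand)
  finally show "kcomp (linearization A C) i j k g (f \<oplus>\<^bsub>Hom i j\<^esub> f') \<gamma>
      = (kcomp (linearization A C) i j k g f \<oplus>\<^bsub>Hom i k\<^esub> kcomp (linearization A C) i j k g f') \<gamma>"
    using \<gamma> by (simp add: Hom_add_apply)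
qed (use assms in \<open>auto intro: comp_closed Hom_add_closed\<close>)

lemma comp_add_left:
  assumes ijk: "i \<in> cobj C" "j \<in> cobj C" "k \<in> cobj C"
    and f: "f \<in> carrier (Hom i j)" and g: "g \<in> carrier (Hom j k)" "g' \<in> carrier (Hom j k)"
  shows "kcomp (linearization A C) i j k (g \<oplus>\<^bsub>Hom j k\<^esub> g') f
    = kcomp (linearization A C) i j k g f \<oplus>\<^bsub>Hom i k\<^esub> kcomp (linearization A C) i j k g' f"
proof (rule Hom_eqI[of _ i k])
  fix \<gamma> assume \<gamma>: "\<gamma> \<in> chom C i k"
  define S where "S = {\<alpha> \<in> chom C i j. f \<alpha> \<noteq> \<zero>\<^bsub>A\<^esub>}"
  define T where "T = {\<beta> \<in> chom C j k. g \<beta> \<noteq> \<zero>\<^bsub>A\<^esub>} \<union> {\<beta> \<in> chom C j k. g' \<beta> \<noteq> \<zero>\<^bsub>A\<^esub>}"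
  have S: "finite S" "S \<subseteq> chom C i j" and T: "finite T" "T \<subseteq> chom C j k"
    and supp: "{\<beta> \<in> chom C j k. g \<beta> \<noteq> \<zero>\<^bsub>A\<^esub>} \<subseteq> T" "{\<beta> \<in> chom C j k. g' \<beta> \<noteq> \<zero>\<^bsub>A\<^esub>} \<subseteq> T"
    using f g Hom_finite_support by (auto simp: S_def T_def)
  have expand: "kcomp (linearization A C) i j k h f \<gamma>
      = finsum A (\<lambda>(\<alpha>, \<beta>). if \<gamma> = ccomp C i j k \<beta> \<alpha> then h \<beta> \<otimes>\<^bsub>A\<^esub> f \<alpha> else \<zero>\<^bsub>A\<^esub>) (S \<times> T)"
    if "h \<in> carrier (Hom j k)" "{\<beta> \<in> chom C j k. h \<beta> \<noteq> \<zero>\<^bsub>A\<^esub>} \<subseteq> T" for h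
    using comp_apply[OF f that(1) \<gamma> S(1) _ S(2) T(1) that(2) T(2)] by (simp add: S_def)
  have closed: "f \<alpha> \<in> carrier A" "g \<beta> \<in> carrier A" "g' \<beta> \<in> carrier A"
    if "\<alpha> \<in> S" "\<beta> \<in> T" for \<alpha> \<beta>
    using that S T f g by (auto simp: Hom_iff)
  have "kcomp (linearization A C) i j k (g \<oplus>\<^bsub>Hom j k\<^esub> g') f \<gamma>
      = finsum A (\<lambda>(\<alpha>, \<beta>). if \<gamma> = ccomp C i j k \<beta> \<alpha>
          then (g \<oplus>\<^bsub>Hom j k\<^esub> g') \<beta> \<otimes>\<^bsub>A\<^esub> f \<alpha> else \<zero>\<^bsub>A\<^esub>) (S \<times> T)"
    using g by (intro expand Hom_add_closed) (auto simp: T_def Hom_add_apply)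
  also have "\<dots> = finsum A (\<lambda>x.
      (case x of (\<alpha>, \<beta>) \<Rightarrow> if \<gamma> = ccomp C i j k \<beta> \<alpha> then g \<beta> \<otimes>\<^bsub>A\<^esub> f \<alpha> else \<zero>\<^bsub>A\<^esub>) \<oplus>\<^bsub>A\<^esub>
      (case x of (\<alpha>, \<beta>) \<Rightarrow> if \<gamma> = ccomp C i j k \<beta> \<alpha> then g' \<beta> \<otimes>\<^bsub>A\<^esub> f \<alpha> else \<zero>\<^bsub>A\<^esub>)) (S \<times> T)"
    using closed T by (intro M.finsum_cong') (auto simp: Hom_add_apply l_distr subset_iff)
  also have "\<dots> = kcomp (linearization A C) i j k g f \<gamma> \<oplus>\<^bsub>A\<^esub> kcomp (linearization A C) i j k g' f \<gamma>"
    using closed g supp by (subst M.finsum_addf) (auto simp: expand)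
  finally show "kcomp (linearization A C) i j k (g \<oplus>\<^bsub>Hom j k\<^esub> g') f \<gamma>
      = (kcomp (linearization A C) i j k g f \<oplus>\<^bsub>Hom i k\<^esub> kcomp (linearization A C) i j k g' f) \<gamma>"
    using \<gamma> by (simp add: Hom_add_apply)
qed (use assms in \<open>auto intro: comp_closed Hom_add_closed\<close>)

lemma comp_single:
  assumes "a \<in> carrier A" "b \<in> carrier A" "\<alpha> \<in> chom C i j" "\<beta> \<in> chom C j k"
  shows "kcomp (linearization A C) i j k (lin_single A C j k b \<beta>) (lin_single A C i j a \<alpha>)
    = lin_single A C i k (b \<otimes>\<^bsub>A\<^esub> a) (ccomp C i j k \<beta> \<alpha>)"
  using linearization_comp_single[OF k_algebra_axioms assms] .

lemma smult_single:
  assumes "r \<in> carrier K" "a \<in> carrier A"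
  shows "r \<odot>\<^bsub>Hom i j\<^esub> lin_single A C i j a \<mu> = lin_single A C i j (r \<odot>\<^bsub>A\<^esub> a) \<mu>"
  using assms
  by (intro Hom_eqI[of _ i j] Hom_smult_closed single_closed)
    (auto simp: Hom_smult_apply single_apply)

text \<open>
  From here on biadditivity and induction over generators reduce each law to the corresponding
  law of \<open>A\<close> and \<open>C\<close>.
\<close>

lemma comp_smult_right:
  assumes "i \<in> cobj C" "j \<in> cobj C" "k \<in> cobj C" and r: "r \<in> carrier K"
    and f: "f \<in> carrier (Hom i j)" and g: "g \<in> carrier (Hom j k)"
  shows "kcomp (linearization A C) i j k g (r \<odot>\<^bsub>Hom i j\<^esub> f)
    = r \<odot>\<^bsub>Hom i k\<^esub> kcomp (linearization A C) i j k g f"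
  using f
proof (induction f rule: Hom_induct)
  case (single a \<alpha>)
  show ?case
    using g
  proof (induction g rule: Hom_induct)
    case (single b \<beta>)
    then show ?case
      using r \<open>a \<in> carrier A\<close> \<open>\<alpha> \<in> chom C i j\<close>
      by (simp add: smult_single comp_single smult_mult_right)
  qed (use assms single in \<open>simp_all add: comp_zero_left comp_add_left single_closed comp_closed
      Hom_smult_closed module.smult_r_null[OF Hom_module] module.smult_r_distr[OF Hom_module]\<close>)
qed (use assms in \<open>simp_all add: comp_zero_right comp_add_right comp_closed
      Hom_smult_closed module.smult_r_null[OF Hom_module] module.smult_r_distr[OF Hom_module]\<close>)

lemma comp_smult_left:
  assumes "i \<in> cobj C" "j \<in> cobj C" "k \<in> cobj C" and r: "r \<in> carrier K"
    and f: "f \<in> carrier (Hom i j)" and g: "g \<in> carrier (Hom j k)"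
  shows "kcomp (linearization A C) i j k (r \<odot>\<^bsub>Hom j k\<^esub> g) f
    = r \<odot>\<^bsub>Hom i k\<^esub> kcomp (linearization A C) i j k g f"
  using f
proof (induction f rule: Hom_induct)
  case (single a \<alpha>)
  show ?case
    using g
  proof (induction g rule: Hom_induct)
    case (single b \<beta>)
    then show ?case
      using r \<open>a \<in> carrier A\<close> \<open>\<alpha> \<in> chom C i j\<close>
      by (simp add: smult_single comp_single smult_mult_left)
  qed (use assms single in \<open>simp_all add: comp_zero_left comp_add_left single_closed comp_closed
      Hom_smult_closed module.smult_r_null[OF Hom_module] module.smult_r_distr[OF Hom_module]\<close>)
qed (use assms in \<open>simp_all add: comp_zero_right comp_add_right comp_closed
      Hom_smult_closed module.smult_r_null[OF Hom_module] module.smult_r_distr[OF Hom_module]\<close>)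

lemma comp_assoc:
  assumes ijkl: "i \<in> cobj C" "j \<in> cobj C" "k \<in> cobj C" "l \<in> cobj C"
    and f: "f \<in> carrier (Hom i j)" and g: "g \<in> carrier (Hom j k)" and h: "h \<in> carrier (Hom k l)"
  shows "kcomp (linearization A C) i k l h (kcomp (linearization A C) i j k g f)
    = kcomp (linearization A C) i j l (kcomp (linearization A C) j k l h g) f"
  using f
proof (induction f rule: Hom_induct)
  case a: (single a \<alpha>)
  show ?case
    using g
  proof (induction g rule: Hom_induct)
    case b: (single b \<beta>)
    show ?case
      using h
    proof (induction h rule: Hom_induct)
      case c: (single c \<gamma>)
      show ?case
        using a b c ijkl by (simp add: comp_single m_assoc cat.comp_closed cat.comp_assoc)
    qed (use ijkl a b in \<open>simp_all add: comp_zero_left comp_add_left single_closed comp_closed\<close>)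
  qed (use ijkl a h in \<open>simp_all add: comp_zero_left comp_zero_right comp_add_left comp_add_right
      single_closed comp_closed\<close>)
qed (use ijkl g h in \<open>simp_all add: comp_zero_right comp_add_right comp_closed\<close>)

lemma comp_id_right:
  assumes ij: "i \<in> cobj C" "j \<in> cobj C" and f: "f \<in> carrier (Hom i j)"
  shows "kcomp (linearization A C) i i j f (kid (linearization A C) i) = f"
  using f
proof (induction f rule: Hom_induct)
  case (single a \<mu>)
  then show ?case
    using ij comp_single[of "\<one>\<^bsub>A\<^esub>" a "cid C i" i i \<mu> j] cat.id_closed cat.id_right
    by (simp add: kid_linearization)
qed (use ij single_closed in \<open>simp_all add: comp_zero_left comp_add_left kid_linearization\<close>)

lemma comp_id_left:
  assumes ij: "i \<in> cobj C" "j \<in> cobj C" and f: "f \<in> carrier (Hom i j)"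
  shows "kcomp (linearization A C) i j j (kid (linearization A C) j) f = f"
  using f
proof (induction f rule: Hom_induct)
  case (single a \<mu>)
  then show ?case
    using ij comp_single[of a "\<one>\<^bsub>A\<^esub>" \<mu> i j "cid C j" j] cat.id_closed cat.id_left
    by (simp add: kid_linearization)
qed (use ij single_closed in \<open>simp_all add: comp_zero_right comp_add_right kid_linearization\<close>)

lemma k_category_linearization: "k_category K (linearization A C)"
proof (intro k_category.intro k_category_axioms.intro category.intro R.cring_axioms)
  fix i assume "i \<in> cobj (under_cat (linearization A C))"
  then show "cid (under_cat (linearization A C)) i \<in> chom (under_cat (linearization A C)) i i"
    using single_closed[of "\<one>\<^bsub>A\<^esub>"] by (simp add: kid_linearization)
qed (auto simp: Hom_module comp_closed comp_assoc comp_id_left comp_id_right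
    comp_add_left comp_add_right comp_smult_left comp_smult_right)

end

section \<open>Linearizations of functors\<close>

text \<open>
  The \<open>A\<close>-linear extension \<open>a \<mu> \<mapsto> a (F \<mu>)\<close>: coefficients are summed over the fibres of \<open>F\<close>.
  The sum is restricted to the support because \<^const>\<open>finsum\<close> is only meaningful over finite
  index sets.
\<close>

definition lin_functor ::
  "('k, 'a) module \<Rightarrow> ('o, 'm) cat \<Rightarrow> ('p, 'n) cat \<Rightarrow> ('o, 'm, 'p, 'n) fdata
    \<Rightarrow> ('o, 'm \<Rightarrow> 'a, 'p, 'n \<Rightarrow> 'a) fdata" where
  "lin_functor A C D F =
    \<lparr>fobj = fobj F,
     fmor = \<lambda>i j f. \<lambda>\<nu>\<in>chom D (fobj F i) (fobj F j).
       finsum A f {\<mu> \<in> chom C i j. f \<mu> \<noteq> \<zero>\<^bsub>A\<^esub> \<and> fmor F i j \<mu> = \<nu>}\<rparr>"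

locale linearized_functor = k_algebra K A + F: cat_functor C D F
  for K :: "'k ring" and A :: "('k, 'a) module" and C :: "('o, 'm) cat"
    and D :: "('p, 'n) cat" and F :: "('o, 'm, 'p, 'n) fdata"
begin

sublocale dom: linearized_category K A C
  by unfold_locales

sublocale cod: linearized_category K A D
  by unfold_locales

abbreviation push :: "'o \<Rightarrow> 'o \<Rightarrow> ('m \<Rightarrow> 'a) \<Rightarrow> 'n \<Rightarrow> 'a" where
  "push \<equiv> fmor (lin_functor A C D F)"

lemma fobj_lin_functor [simp]: "fobj (lin_functor A C D F) = fobj F"
  by (simp add: lin_functor_def)

lemma push_apply:
  assumes f: "f \<in> carrier (dom.Hom i j)" and \<nu>: "\<nu> \<in> chom D (fobj F i) (fobj F j)"
    and S: "finite S" "{\<mu> \<in> chom C i j. f \<mu> \<noteq> \<zero>\<^bsub>A\<^esub>} \<subseteq> S" "S \<subseteq> chom C i j"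
  shows "push i j f \<nu> = finsum A (\<lambda>\<mu>. if fmor F i j \<mu> = \<nu> then f \<mu> else \<zero>\<^bsub>A\<^esub>) S"
proof -
  have "finsum A f {\<mu> \<in> chom C i j. f \<mu> \<noteq> \<zero>\<^bsub>A\<^esub> \<and> fmor F i j \<mu> = \<nu>}
    = finsum A (\<lambda>\<mu>. if fmor F i j \<mu> = \<nu> then f \<mu> else \<zero>\<^bsub>A\<^esub>) S"
  proof (rule M.add.finprod_mono_neutral_cong_left)
    show "(\<lambda>\<mu>. if fmor F i j \<mu> = \<nu> then f \<mu> else \<zero>\<^bsub>A\<^esub>) \<in> S \<rightarrow> carrier A"
      using dom.Hom_apply_closed[OF f] S(3) by auto
  qed (use S in auto)
  then show ?thesis
    using \<nu> by (simp add: lin_functor_def)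
qed

lemma push_closed:
  assumes f: "f \<in> carrier (dom.Hom i j)"
  shows "push i j f \<in> carrier (cod.Hom (fobj F i) (fobj F j))"
proof -
  let ?S = "{\<mu> \<in> chom C i j. f \<mu> \<noteq> \<zero>\<^bsub>A\<^esub>}"
  have fin: "finite ?S"
    using f by (rule dom.Hom_finite_support)
  have push: "push i j f \<nu> = finsum A (\<lambda>\<mu>. if fmor F i j \<mu> = \<nu> then f \<mu> else \<zero>\<^bsub>A\<^esub>) ?S"
    if "\<nu> \<in> chom D (fobj F i) (fobj F j)" for \<nu>
    using push_apply[OF f that fin] by auto
  have "push i j f \<nu> \<in> carrier A" if "\<nu> \<in> chom D (fobj F i) (fobj F j)" for \<nu>
    unfolding push[OF that] by (rule M.finsum_closed) (auto simp: dom.Hom_apply_closed[OF f])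
  moreover have "push i j f \<nu> = \<zero>\<^bsub>A\<^esub>"
    if "\<nu> \<in> chom D (fobj F i) (fobj F j)" "\<nu> \<notin> fmor F i j ` ?S" for \<nu>
  proof -
    have "push i j f \<nu> = finsum A (\<lambda>_. \<zero>\<^bsub>A\<^esub>) ?S"
      unfolding push[OF that(1)] using that(2) by (intro M.finsum_cong') auto
    then show ?thesis
      by (simp add: M.finsum_zero)
  qed
  then have "finite {\<nu> \<in> chom D (fobj F i) (fobj F j). push i j f \<nu> \<noteq> \<zero>\<^bsub>A\<^esub>}"
    by (intro finite_subset[OF _ finite_imageI[OF fin, of "fmor F i j"]]) blast
  moreover have "push i j f \<in> extensional (chom D (fobj F i) (fobj F j))"
    by (simp add: lin_functor_def)
  ultimately show ?thesis
    by (simp add: cod.Hom_iff)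
qed

lemma push_zero: "push i j \<zero>\<^bsub>dom.Hom i j\<^esub> = \<zero>\<^bsub>cod.Hom (fobj F i) (fobj F j)\<^esub>"
proof (rule cod.Hom_eqI[OF push_closed[OF dom.Hom_zero_closed] cod.Hom_zero_closed])
  fix \<nu> assume \<nu>: "\<nu> \<in> chom D (fobj F i) (fobj F j)"
  have "{\<mu> \<in> chom C i j. \<zero>\<^bsub>dom.Hom i j\<^esub> \<mu> \<noteq> \<zero>\<^bsub>A\<^esub>} \<subseteq> {}"
    by (auto simp: dom.Hom_zero_apply)
  from push_apply[OF dom.Hom_zero_closed \<nu> _ this]
  show "push i j \<zero>\<^bsub>dom.Hom i j\<^esub> \<nu> = \<zero>\<^bsub>cod.Hom (fobj F i) (fobj F j)\<^esub> \<nu>"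
    using \<nu> by (simp add: cod.Hom_zero_apply M.finsum_empty)
qed

lemma push_add:
  assumes f: "f \<in> carrier (dom.Hom i j)" "g \<in> carrier (dom.Hom i j)"
  shows "push i j (f \<oplus>\<^bsub>dom.Hom i j\<^esub> g)
    = push i j f \<oplus>\<^bsub>cod.Hom (fobj F i) (fobj F j)\<^esub> push i j g"
proof (rule cod.Hom_eqI)
  fix \<nu> assume \<nu>: "\<nu> \<in> chom D (fobj F i) (fobj F j)"
  define S where "S = {\<mu> \<in> chom C i j. f \<mu> \<noteq> \<zero>\<^bsub>A\<^esub>} \<union> {\<mu> \<in> chom C i j. g \<mu> \<noteq> \<zero>\<^bsub>A\<^esub>}"
  have S: "finite S" "S \<subseteq> chom C i j"
    and supp: "{\<mu> \<in> chom C i j. f \<mu> \<noteq> \<zero>\<^bsub>A\<^esub>} \<subseteq> S" "{\<mu> \<in> chom C i j. g \<mu> \<noteq> \<zero>\<^bsub>A\<^esub>} \<subseteq> S"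
    using f dom.Hom_finite_support by (auto simp: S_def)
  have closed: "f \<mu> \<in> carrier A" "g \<mu> \<in> carrier A" if "\<mu> \<in> S" for \<mu>
    using that S(2) dom.Hom_apply_closed f by auto
  have "push i j (f \<oplus>\<^bsub>dom.Hom i j\<^esub> g) \<nu>
      = finsum A (\<lambda>\<mu>. if fmor F i j \<mu> = \<nu> then (f \<oplus>\<^bsub>dom.Hom i j\<^esub> g) \<mu> else \<zero>\<^bsub>A\<^esub>) S"
    using f \<nu> S by (intro push_apply dom.Hom_add_closed) (auto simp: S_def dom.Hom_add_apply)
  also have "\<dots> = finsum A (\<lambda>\<mu>. (if fmor F i j \<mu> = \<nu> then f \<mu> else \<zero>\<^bsub>A\<^esub>) \<oplus>\<^bsub>A\<^esub>
      (if fmor F i j \<mu> = \<nu> then g \<mu> else \<zero>\<^bsub>A\<^esub>)) S"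
    using closed S(2) by (intro M.finsum_cong') (auto simp: dom.Hom_add_apply subset_iff)
  also have "\<dots> = push i j f \<nu> \<oplus>\<^bsub>A\<^esub> push i j g \<nu>"
    using closed
    by (subst M.finsum_addf)
      (auto simp: push_apply[OF f(1) \<nu> S(1) supp(1) S(2)] push_apply[OF f(2) \<nu> S(1) supp(2) S(2)])
  finally show "push i j (f \<oplus>\<^bsub>dom.Hom i j\<^esub> g) \<nu>
      = (push i j f \<oplus>\<^bsub>cod.Hom (fobj F i) (fobj F j)\<^esub> push i j g) \<nu>"
    using \<nu> by (simp add: cod.Hom_add_apply)
qed (use f in \<open>auto intro: push_closed dom.Hom_add_closed cod.Hom_add_closed\<close>)

lemma push_single:
  assumes a: "a \<in> carrier A" and \<mu>: "\<mu> \<in> chom C i j"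
  shows "push i j (lin_single A C i j a \<mu>)
    = lin_single A D (fobj F i) (fobj F j) a (fmor F i j \<mu>)"
proof (rule cod.Hom_eqI[OF push_closed[OF dom.single_closed[OF a]] cod.single_closed[OF a]])
  fix \<nu> assume \<nu>: "\<nu> \<in> chom D (fobj F i) (fobj F j)"
  have "push i j (lin_single A C i j a \<mu>) \<nu> = finsum A
      (\<lambda>\<mu>'. if fmor F i j \<mu>' = \<nu> then lin_single A C i j a \<mu> \<mu>' else \<zero>\<^bsub>A\<^esub>) {\<mu>}"
    using \<mu> by (intro push_apply dom.single_closed a \<nu>)
      (auto simp: dom.single_apply split: if_splits)
  also have "\<dots> = lin_single A D (fobj F i) (fobj F j) a (fmor F i j \<mu>) \<nu>"
    using a \<mu> \<nu> by (simp add: dom.single_apply cod.single_apply M.finsum_insert M.finsum_empty)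
  finally show "push i j (lin_single A C i j a \<mu>) \<nu>
      = lin_single A D (fobj F i) (fobj F j) a (fmor F i j \<mu>) \<nu>" .
qed

lemma push_smult:
  assumes r: "r \<in> carrier K" and f: "f \<in> carrier (dom.Hom i j)"
  shows "push i j (r \<odot>\<^bsub>dom.Hom i j\<^esub> f) = r \<odot>\<^bsub>cod.Hom (fobj F i) (fobj F j)\<^esub> push i j f"
  using f
proof (induction f rule: dom.Hom_induct)
  case zero
  then show ?case
    using r by (simp add: module.smult_r_null[OF dom.Hom_module] push_zero
        module.smult_r_null[OF cod.Hom_module])
next
  case (single a \<mu>)
  then show ?case
    using r by (simp add: dom.smult_single cod.smult_single push_single)
next
  case (add f g)
  then show ?case
    using r by (simp add: module.smult_r_distr[OF dom.Hom_module] push_add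
        module.smult_r_distr[OF cod.Hom_module] dom.Hom_smult_closed push_closed)
qed

lemma push_comp:
  assumes ijk: "i \<in> cobj C" "j \<in> cobj C" "k \<in> cobj C"
    and f: "f \<in> carrier (dom.Hom i j)" and g: "g \<in> carrier (dom.Hom j k)"
  shows "push i k (kcomp (linearization A C) i j k g f)
    = kcomp (linearization A D) (fobj F i) (fobj F j) (fobj F k) (push j k g) (push i j f)"
  using f
proof (induction f rule: dom.Hom_induct)
  case a: (single a \<alpha>)
  show ?case
    using g
  proof (induction g rule: dom.Hom_induct)
    case (single b \<beta>)
    then show ?case
      using a ijk by (simp add: dom.comp_single cod.comp_single push_single F.mor_closed
          F.mor_comp F.source.comp_closed)
  qed (use ijk a in \<open>simp_all add: dom.comp_zero_left cod.comp_zero_left push_zero push_add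
      dom.comp_add_left cod.comp_add_left dom.single_closed push_closed dom.comp_closed
      F.obj_closed\<close>)
qed (use ijk g in \<open>simp_all add: dom.comp_zero_right cod.comp_zero_right push_zero push_add
    dom.comp_add_right cod.comp_add_right push_closed dom.comp_closed F.obj_closed\<close>)

lemma k_functor_lin_functor:
  "k_functor K (linearization A C) (linearization A D) (lin_functor A C D F)"
  by (intro k_functorI dom.k_category_linearization cod.k_category_linearization)
    (simp_all add: F.obj_closed push_closed push_comp push_add push_smult push_single
      dom.kid_linearization cod.kid_linearization F.source.id_closed F.mor_id)

lemma push_onto:
  assumes full: "fmor F i j ` chom C i j = chom D (fobj F i) (fobj F j)"
  shows "push i j ` carrier (dom.Hom i j) = carrier (cod.Hom (fobj F i) (fobj F j))"
proof -
  have "h \<in> push i j ` carrier (dom.Hom i j)" if "h \<in> carrier (cod.Hom (fobj F i) (fobj F j))" for h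
    using that
  proof (induction h rule: cod.Hom_induct)
    case zero
    show ?case
      using push_zero dom.Hom_zero_closed by (metis imageI)
  next
    case (single a \<nu>)
    then obtain \<mu> where "\<mu> \<in> chom C i j" "\<nu> = fmor F i j \<mu>"
      using full by blast
    then show ?case
      using single push_single dom.single_closed by (metis imageI)
  next
    case (add g h)
    then show ?case
      using push_add dom.Hom_add_closed by (smt (verit) imageE imageI)
  qed
  then show ?thesis
    using push_closed by blast
qed

end

section \<open>Quotient categories\<close>

lemma rel_sharp_least: "\<lbrakk>equiv (chom C i j) E; rel_c C R i j \<subseteq> E\<rbrakk> \<Longrightarrow> rel_sharp C R i j \<subseteq> E"
  by (auto simp: rel_sharp_def)

definition quotient_cat_functor ::
  "('o, 'm) cat \<Rightarrow> ('m \<times> 'm) set \<Rightarrow> ('o, 'm, 'o, 'm set) fdata" where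
  "quotient_cat_functor C R = \<lparr>fobj = \<lambda>i. i, fmor = \<lambda>i j f. rel_sharp C R i j `` {f}\<rparr>"

lemma UN_UN_constant:
  assumes "X \<noteq> {}" "Y \<noteq> {}" "\<And>x y. \<lbrakk>x \<in> X; y \<in> Y\<rbrakk> \<Longrightarrow> h x y = c"
  shows "(\<Union>x\<in>X. \<Union>y\<in>Y. h x y) = c"
proof -
  have "(\<Union>x\<in>X. \<Union>y\<in>Y. h x y) = (\<Union>x\<in>X. \<Union>y\<in>Y. c)"
    using assms(3) by (intro SUP_cong refl) simp
  then show ?thesis
    using assms(1,2) by simp
qed

context category
begin

lemma rel_c_subset: "\<lbrakk>i \<in> cobj C; j \<in> cobj C\<rbrakk> \<Longrightarrow> rel_c C R i j \<subseteq> chom C i j \<times> chom C i j"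
  by (fastforce simp: rel_c_def rel_at_def intro: comp_closed)

lemma equiv_rel_sharp:
  assumes "i \<in> cobj C" "j \<in> cobj C"
  shows "equiv (chom C i j) (rel_sharp C R i j)"
proof (rule equivI)
  have "equiv (chom C i j) (chom C i j \<times> chom C i j)"
    by (auto simp: equiv_def refl_on_def sym_def trans_def)
  then show "rel_sharp C R i j \<subseteq> chom C i j \<times> chom C i j"
    using rel_c_subset[OF assms] by (rule rel_sharp_least)
  show "refl_on (chom C i j) (rel_sharp C R i j)"
    by (auto simp: rel_sharp_def refl_on_def equiv_def)
  show "sym (rel_sharp C R i j)"
    unfolding rel_sharp_def by (rule symI) (auto simp: equiv_def dest: symD)
  show "trans (rel_sharp C R i j)"
    unfolding rel_sharp_def by (rule transI) (auto simp: equiv_def dest: transD)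
qed

lemma rel_c_subset_rel_sharp: "rel_c C R i j \<subseteq> rel_sharp C R i j"
  by (auto simp: rel_sharp_def)

lemma rel_sharp_closed:
  "\<lbrakk>i \<in> cobj C; j \<in> cobj C; (a, b) \<in> rel_sharp C R i j\<rbrakk> \<Longrightarrow> a \<in> chom C i j \<and> b \<in> chom C i j"
  using equiv_rel_sharp[of i j R] by (auto simp: equiv_def)

lemma rel_c_comp_left:
  assumes ijk: "i \<in> cobj C" "j \<in> cobj C" "k \<in> cobj C"
    and ab: "(a, b) \<in> rel_c C R i j" and d: "d \<in> chom C j k"
  shows "(ccomp C i j k d a, ccomp C i j k d b) \<in> rel_c C R i k"
proof -
  obtain p q x y c e where pq: "p \<in> cobj C" "q \<in> cobj C" "c \<in> chom C i p" "e \<in> chom C q j"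
      "(x, y) \<in> rel_at C R p q"
      "a = ccomp C i q j e (ccomp C i p q x c)" "b = ccomp C i q j e (ccomp C i p q y c)"
    using ab unfolding rel_c_def by blast
  then have xy: "x \<in> chom C p q" "y \<in> chom C p q"
    by (auto simp: rel_at_def)
  have "ccomp C i j k d a = ccomp C i q k (ccomp C q j k d e) (ccomp C i p q x c)"
    and "ccomp C i j k d b = ccomp C i q k (ccomp C q j k d e) (ccomp C i p q y c)"
    using ijk pq xy d by (simp_all add: comp_assoc comp_closed)
  moreover have "ccomp C q j k d e \<in> chom C q k"
    using ijk pq d by (simp add: comp_closed)
  ultimately show ?thesis
    using pq unfolding rel_c_def by blast
qed

lemma rel_c_comp_right:
  assumes ijk: "i \<in> cobj C" "j \<in> cobj C" "k \<in> cobj C"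
    and ab: "(a, b) \<in> rel_c C R j k" and d: "d \<in> chom C i j"
  shows "(ccomp C i j k a d, ccomp C i j k b d) \<in> rel_c C R i k"
proof -
  obtain p q x y c e where pq: "p \<in> cobj C" "q \<in> cobj C" "c \<in> chom C j p" "e \<in> chom C q k"
      "(x, y) \<in> rel_at C R p q"
      "a = ccomp C j q k e (ccomp C j p q x c)" "b = ccomp C j q k e (ccomp C j p q y c)"
    using ab unfolding rel_c_def by blast
  then have xy: "x \<in> chom C p q" "y \<in> chom C p q"
    by (auto simp: rel_at_def)
  have "ccomp C i j k a d = ccomp C i q k e (ccomp C i p q x (ccomp C i j p c d))"
    and "ccomp C i j k b d = ccomp C i q k e (ccomp C i p q y (ccomp C i j p c d))"
    using ijk pq xy d
    by (simp_all add: comp_assoc[of i j q k, symmetric] comp_assoc[of i j p q, symmetric] comp_closed)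
  moreover have "ccomp C i j p c d \<in> chom C i p"
    using ijk pq d by (simp add: comp_closed)
  ultimately show ?thesis
    using pq unfolding rel_c_def by blast
qed

lemma equiv_inv_image:
  assumes "equiv B E" "\<And>a. a \<in> A \<Longrightarrow> h a \<in> B"
  shows "equiv A {(a, b). a \<in> A \<and> b \<in> A \<and> (h a, h b) \<in> E}"
  using assms unfolding equiv_def refl_on_def sym_def trans_def by blast

text \<open>
  The pairs that stay related after a fixed composition form an equivalence relation, which
  contains the elementary relations; minimality then yields compatibility with composition.
\<close>

lemma rel_sharp_comp_left:
  assumes ijk: "i \<in> cobj C" "j \<in> cobj C" "k \<in> cobj C"
    and ab: "(a, b) \<in> rel_sharp C R i j" and d: "d \<in> chom C j k"
  shows "(ccomp C i j k d a, ccomp C i j k d b) \<in> rel_sharp C R i k"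
proof -
  let ?E = "{(a, b). a \<in> chom C i j \<and> b \<in> chom C i j \<and>
    (ccomp C i j k d a, ccomp C i j k d b) \<in> rel_sharp C R i k}"
  have "equiv (chom C i j) ?E"
    using ijk d
    by (intro equiv_inv_image[OF equiv_rel_sharp[OF ijk(1,3)], where h = "\<lambda>a. ccomp C i j k d a"] comp_closed)
  moreover have "rel_c C R i j \<subseteq> ?E"
    using rel_c_subset[OF ijk(1,2), of R] rel_c_comp_left[OF ijk _ d] rel_c_subset_rel_sharp[of R i k]
    by auto
  ultimately have "rel_sharp C R i j \<subseteq> ?E"
    by (rule rel_sharp_least)
  then show ?thesis
    using ab by auto
qed

lemma rel_sharp_comp_right:
  assumes ijk: "i \<in> cobj C" "j \<in> cobj C" "k \<in> cobj C"
    and ab: "(a, b) \<in> rel_sharp C R j k" and d: "d \<in> chom C i j"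
  shows "(ccomp C i j k a d, ccomp C i j k b d) \<in> rel_sharp C R i k"
proof -
  let ?E = "{(a, b). a \<in> chom C j k \<and> b \<in> chom C j k \<and>
    (ccomp C i j k a d, ccomp C i j k b d) \<in> rel_sharp C R i k}"
  have "equiv (chom C j k) ?E"
    using ijk d
    by (intro equiv_inv_image[OF equiv_rel_sharp[OF ijk(1,3)], where h = "\<lambda>a. ccomp C i j k a d"] comp_closed)
  moreover have "rel_c C R j k \<subseteq> ?E"
    using rel_c_subset[OF ijk(2,3), of R] rel_c_comp_right[OF ijk _ d] rel_c_subset_rel_sharp[of R i k]
    by auto
  ultimately have "rel_sharp C R j k \<subseteq> ?E"
    by (rule rel_sharp_least)
  then show ?thesis
    using ab by auto
qed

lemma quotient_cat_comp:
  assumes ijk: "i \<in> cobj C" "j \<in> cobj C" "k \<in> cobj C"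
    and f: "f \<in> chom C i j" and g: "g \<in> chom C j k"
  shows "ccomp (quotient_cat C R) i j k (rel_sharp C R j k `` {g}) (rel_sharp C R i j `` {f})
    = rel_sharp C R i k `` {ccomp C i j k g f}"
proof -
  have comp: "ccomp (quotient_cat C R) i j k G F
      = (\<Union>g\<in>G. \<Union>f\<in>F. rel_sharp C R i k `` {ccomp C i j k g f})" for F G
    by (simp add: quotient_cat_def)
  have "rel_sharp C R i k `` {ccomp C i j k g' f'} = rel_sharp C R i k `` {ccomp C i j k g f}"
    if g': "(g, g') \<in> rel_sharp C R j k" and f': "(f, f') \<in> rel_sharp C R i j" for f' g'
  proof -
    have "(ccomp C i j k g f, ccomp C i j k g' f) \<in> rel_sharp C R i k"
      using rel_sharp_comp_right[OF ijk g' f] .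
    moreover have "(ccomp C i j k g' f, ccomp C i j k g' f') \<in> rel_sharp C R i k"
      using rel_sharp_comp_left[OF ijk f'] rel_sharp_closed[OF ijk(2,3) g'] by blast
    ultimately show ?thesis
      using equiv_class_eq[OF equiv_rel_sharp[OF ijk(1,3)]] by metis
  qed
  moreover have "(f, f) \<in> rel_sharp C R i j" "(g, g) \<in> rel_sharp C R j k"
    using equiv_rel_sharp ijk f g by (auto simp: equiv_def refl_on_def)
  ultimately show ?thesis
    unfolding comp by (intro UN_UN_constant) blast+
qed

lemma cat_functor_quotient_cat: "cat_functor C (quotient_cat C R) (quotient_cat_functor C R)"
proof -
  have obj: "cobj (quotient_cat C R) = cobj C"
    and hom: "chom (quotient_cat C R) i j = (\<lambda>f. rel_sharp C R i j `` {f}) ` chom C i j"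
    and id: "cid (quotient_cat C R) i = rel_sharp C R i i `` {cid C i}" for i j
    by (auto simp: quotient_cat_def quotient_def)
  have "category (quotient_cat C R)"
    by (intro category.intro)
      (auto simp: obj hom id quotient_cat_comp id_closed comp_closed id_left id_right comp_assoc)
  then show ?thesis
    by (intro cat_functor.intro cat_functor_axioms.intro category_axioms)
      (auto simp: quotient_cat_functor_def obj hom id quotient_cat_comp)
qed

end

section \<open>Relations in linearizations\<close>

text \<open>
  Moving each coefficient of \<open>f\<close> from its morphism \<open>\<mu>\<close> to a chosen representative of the fibre
  of \<open>F\<close> through \<open>\<mu>\<close> does not change the value of \<open>G\<close>, by the hypothesis on fibres. The result
  of this move depends only on the image of \<open>f\<close> under the linearization of \<open>F\<close>.
\<close>

lemma (in linearized_functor) push_eq_imp_eq: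
  assumes G: "k_functor K (linearization A C) B G"
    and ij: "i \<in> cobj C" "j \<in> cobj C"
    and full: "fmor F i j ` chom C i j = chom D (fobj F i) (fobj F j)"
    and fibres: "\<And>\<mu> \<mu>'. \<lbrakk>\<mu> \<in> chom C i j; \<mu>' \<in> chom C i j; fmor F i j \<mu> = fmor F i j \<mu>'\<rbrakk>
      \<Longrightarrow> fmor G i j (lin_single A C i j \<one>\<^bsub>A\<^esub> \<mu>) = fmor G i j (lin_single A C i j \<one>\<^bsub>A\<^esub> \<mu>')"
    and f: "f \<in> carrier (dom.Hom i j)" and g: "g \<in> carrier (dom.Hom i j)"
    and eq: "push i j f = push i j g"
  shows "fmor G i j f = fmor G i j g"
proof -
  interpret G: k_functor K "linearization A C" B G by fact
  \<comment> \<open>\<open>s\<close> chooses the representatives, and \<open>\<sigma>\<close> is the additive section \<open>a \<nu> \<mapsto> a (s \<nu>)\<close> that it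
    induces.\<close>
  define s where "s = inv_into (chom C i j) (fmor F i j)"
  define \<sigma> where "\<sigma> h =
    (\<lambda>\<mu>\<in>chom C i j. if \<mu> = s (fmor F i j \<mu>) then h (fmor F i j \<mu>) else \<zero>\<^bsub>A\<^esub>)" for h :: "'n \<Rightarrow> 'a"
  have s: "s \<nu> \<in> chom C i j" "fmor F i j (s \<nu>) = \<nu>" if "\<nu> \<in> chom D (fobj F i) (fobj F j)" for \<nu>
    using that full unfolding s_def by (metis inv_into_into, metis f_inv_into_f)
  have F_mem: "fmor F i j \<mu> \<in> chom D (fobj F i) (fobj F j)" if "\<mu> \<in> chom C i j" for \<mu>
    using that full by blast
  have \<sigma>_closed: "\<sigma> h \<in> carrier (dom.Hom i j)" if h: "h \<in> carrier (cod.Hom (fobj F i) (fobj F j))" for h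
  proof -
    have "finite {\<mu> \<in> chom C i j. \<sigma> h \<mu> \<noteq> \<zero>\<^bsub>A\<^esub>}"
    proof (rule finite_subset)
      show "{\<mu> \<in> chom C i j. \<sigma> h \<mu> \<noteq> \<zero>\<^bsub>A\<^esub>}
          \<subseteq> s ` {\<nu> \<in> chom D (fobj F i) (fobj F j). h \<nu> \<noteq> \<zero>\<^bsub>A\<^esub>}"
        using F_mem by (auto simp: \<sigma>_def split: if_splits)
      show "finite (s ` {\<nu> \<in> chom D (fobj F i) (fobj F j). h \<nu> \<noteq> \<zero>\<^bsub>A\<^esub>})"
        using h by (intro finite_imageI cod.Hom_finite_support)
    qed
    then show ?thesis
      using F_mem cod.Hom_apply_closed[OF h] by (auto simp: dom.Hom_iff \<sigma>_def)
  qed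
  have \<sigma>_zero: "\<sigma> \<zero>\<^bsub>cod.Hom (fobj F i) (fobj F j)\<^esub> = \<zero>\<^bsub>dom.Hom i j\<^esub>"
    by (rule dom.Hom_eqI[OF \<sigma>_closed[OF cod.Hom_zero_closed] dom.Hom_zero_closed])
      (simp add: \<sigma>_def dom.Hom_zero_apply cod.Hom_zero_apply F_mem)
  have \<sigma>_add: "\<sigma> (h \<oplus>\<^bsub>cod.Hom (fobj F i) (fobj F j)\<^esub> h') = \<sigma> h \<oplus>\<^bsub>dom.Hom i j\<^esub> \<sigma> h'"
    if h: "h \<in> carrier (cod.Hom (fobj F i) (fobj F j))" "h' \<in> carrier (cod.Hom (fobj F i) (fobj F j))"
    for h h'
    by (rule dom.Hom_eqI[OF \<sigma>_closed[OF cod.Hom_add_closed[OF h]]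
          dom.Hom_add_closed[OF \<sigma>_closed[OF h(1)] \<sigma>_closed[OF h(2)]]])
      (simp add: \<sigma>_def dom.Hom_add_apply cod.Hom_add_apply F_mem)
  have \<sigma>_single: "\<sigma> (lin_single A D (fobj F i) (fobj F j) a \<nu>) = lin_single A C i j a (s \<nu>)"
    if a: "a \<in> carrier A" and \<nu>: "\<nu> \<in> chom D (fobj F i) (fobj F j)" for a \<nu>
    by (rule dom.Hom_eqI[OF \<sigma>_closed[OF cod.single_closed[OF a]] dom.single_closed[OF a]])
      (use s[OF \<nu>] F_mem \<nu> in \<open>auto simp: \<sigma>_def dom.single_apply cod.single_apply\<close>)
  have "fmor G i j f = fmor G i j (\<sigma> (push i j f))" if "f \<in> carrier (dom.Hom i j)" for f
    using that
  proof (induction f rule: dom.Hom_induct)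
    case zero
    then show ?case
      by (simp add: push_zero \<sigma>_zero)
  next
    case (single a \<mu>)
    \<comment> \<open>Composing with \<open>a\<close> times an identity extends the hypothesis on fibres from the coefficient
      \<open>1\<close> to \<open>a\<close>; the \<open>K\<close>-linearity of \<open>G\<close> only covers coefficients in \<open>K\<close>.\<close>
    let ?e = "lin_single A C j j a (cid C j)"
    have split: "lin_single A C i j a \<kappa>
        = kcomp (linearization A C) i j j ?e (lin_single A C i j \<one>\<^bsub>A\<^esub> \<kappa>)" if "\<kappa> \<in> chom C i j" for \<kappa>
      using that single(1) ij by (simp add: dom.comp_single F.source.id_closed F.source.id_left)
    have \<mu>: "fmor F i j \<mu> \<in> chom D (fobj F i) (fobj F j)"
      using F_mem single(2) .
    have "fmor G i j (lin_single A C i j \<one>\<^bsub>A\<^esub> \<mu>)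
        = fmor G i j (lin_single A C i j \<one>\<^bsub>A\<^esub> (s (fmor F i j \<mu>)))"
      using s[OF \<mu>] single(2) by (intro fibres) simp_all
    then have "fmor G i j (lin_single A C i j a \<mu>)
        = fmor G i j (lin_single A C i j a (s (fmor F i j \<mu>)))"
      using s(1)[OF \<mu>] single ij G.mor_comp[of i j j _ ?e] dom.single_closed
      by (simp add: split)
    then show ?case
      using single \<mu> by (simp add: push_single \<sigma>_single)
  next
    case (add f g)
    then show ?case
      using ij G.mor_add[of i j] by (simp add: push_add \<sigma>_add push_closed \<sigma>_closed)
  qed
  from this[OF f] this[OF g] eq show ?thesis
    by simp
qed

context linearized_category
begin

text \<open>
  The pairs of morphisms that \<open>G\<close> identifies form an equivalence relation, and by functoriality
  it contains \<open>(d a c, d b c)\<close> together with \<open>(a, b)\<close>. Hence it contains \<open>R\<^sup>#\<close>.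
\<close>

lemma rel_sharp_imp_eq:
  assumes G: "k_functor K (linearization A C) B G"
    and R: "\<And>i j g h. \<lbrakk>i \<in> cobj C; j \<in> cobj C; (g, h) \<in> rel_at C R i j\<rbrakk>
      \<Longrightarrow> fmor G i j (lin_single A C i j \<one>\<^bsub>A\<^esub> g) = fmor G i j (lin_single A C i j \<one>\<^bsub>A\<^esub> h)"
    and kl: "k \<in> cobj C" "l \<in> cobj C" and pq: "(p, q) \<in> rel_sharp C R k l"
  shows "fmor G k l (lin_single A C k l \<one>\<^bsub>A\<^esub> p) = fmor G k l (lin_single A C k l \<one>\<^bsub>A\<^esub> q)"
proof -
  interpret G: k_functor K "linearization A C" B G by fact
  let ?E = "{(p, q). p \<in> chom C k l \<and> q \<in> chom C k l \<and>
    fmor G k l (lin_single A C k l \<one>\<^bsub>A\<^esub> p) = fmor G k l (lin_single A C k l \<one>\<^bsub>A\<^esub> q)}"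
  have "equiv (chom C k l) ?E"
    by (auto simp: equiv_def refl_on_def sym_def trans_def)
  moreover have "rel_c C R k l \<subseteq> ?E"
  proof (rule subrelI)
    fix x y assume xy: "(x, y) \<in> rel_c C R k l"
    then obtain i j a b c d where ij: "i \<in> cobj C" "j \<in> cobj C"
      and cd: "c \<in> chom C k i" "d \<in> chom C j l" and ab: "(a, b) \<in> rel_at C R i j"
      and x: "x = ccomp C k j l d (ccomp C k i j a c)"
      and y: "y = ccomp C k j l d (ccomp C k i j b c)"
      unfolding rel_c_def by blast
    have expand: "fmor G k l (lin_single A C k l \<one>\<^bsub>A\<^esub> (ccomp C k j l d (ccomp C k i j z c)))
        = kcomp B (fobj G k) (fobj G j) (fobj G l) (fmor G j l (lin_single A C j l \<one>\<^bsub>A\<^esub> d))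
            (kcomp B (fobj G k) (fobj G i) (fobj G j) (fmor G i j (lin_single A C i j \<one>\<^bsub>A\<^esub> z))
              (fmor G k i (lin_single A C k i \<one>\<^bsub>A\<^esub> c)))"
      if z: "z \<in> chom C i j" for z
    proof -
      have "lin_single A C k l \<one>\<^bsub>A\<^esub> (ccomp C k j l d (ccomp C k i j z c))
          = kcomp (linearization A C) k j l (lin_single A C j l \<one>\<^bsub>A\<^esub> d)
              (kcomp (linearization A C) k i j (lin_single A C i j \<one>\<^bsub>A\<^esub> z) (lin_single A C k i \<one>\<^bsub>A\<^esub> c))"
        using z cd ij kl by (simp add: comp_single cat.comp_closed)
      then show ?thesis
        using ij kl by (simp add: G.mor_comp[simplified] comp_closed single_closed)
    qed
    have "a \<in> chom C i j" "b \<in> chom C i j"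
      using ab by (auto simp: rel_at_def)
    then show "(x, y) \<in> ?E"
      using cat.rel_c_subset[OF kl] xy expand R[OF ij ab] by (auto simp: x y)
  qed
  ultimately have "rel_sharp C R k l \<subseteq> ?E"
    by (rule rel_sharp_least)
  then show ?thesis
    using pq by auto
qed

abbreviation relators :: "('m \<times> 'm) set \<Rightarrow> 'o \<Rightarrow> 'o \<Rightarrow> ('m \<Rightarrow> 'a) set" where
  "relators R i j \<equiv> {lin_single A C i j \<one>\<^bsub>A\<^esub> g \<ominus>\<^bsub>Hom i j\<^esub> lin_single A C i j \<one>\<^bsub>A\<^esub> h
    | g h. (g, h) \<in> rel_at C R i j}"

text \<open>
  The kernel is an ideal that contains the generators. Conversely, let \<open>J\<close> be any such ideal.
  The projection modulo \<open>J\<close> identifies morphisms related by \<open>R\<close>, hence those related by \<open>R\<^sup>#\<close>,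
  that is, those in one fibre of the projection of \<open>C\<close>; so it sends the whole kernel to zero.
\<close>

lemma ideal_generated_relators:
  assumes ij: "i \<in> cobj C" "j \<in> cobj C"
  shows "ideal_generated K (linearization A C) (relators R) i j =
    {f \<in> carrier (Hom i j).
      fmor (lin_functor A C (quotient_cat C R) (quotient_cat_functor C R)) i j f
        = \<zero>\<^bsub>khom (linearization A (quotient_cat C R)) i j\<^esub>}"
    (is "_ = ?ker i j")
proof -
  let ?F = "quotient_cat_functor C R" and ?D = "quotient_cat C R"
  interpret F: cat_functor C ?D ?F
    by (rule cat.cat_functor_quotient_cat)
  interpret F: linearized_functor K A C ?D ?F
    by unfold_locales
  interpret P: k_functor K "linearization A C" "linearization A ?D" "lin_functor A C ?D ?F"
    by (rule F.k_functor_lin_functor)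
  have F_obj [simp]: "fobj ?F i = i" for i
    by (simp add: quotient_cat_functor_def)
  have F_full: "fmor ?F i j ` chom C i j = chom ?D (fobj ?F i) (fobj ?F j)" for i j
    by (auto simp: quotient_cat_functor_def quotient_cat_def quotient_def)
  have F_eq: "fmor ?F i j g = fmor ?F i j h \<longleftrightarrow> (g, h) \<in> rel_sharp C R i j"
    if "i \<in> cobj C" "j \<in> cobj C" "g \<in> chom C i j" "h \<in> chom C i j" for i j g h
    using eq_equiv_class_iff[OF cat.equiv_rel_sharp[OF that(1,2)] that(3,4)]
    by (simp add: quotient_cat_functor_def)
  have rel_at_sharp: "(g, h) \<in> rel_sharp C R i j"
    if gh: "(g, h) \<in> rel_at C R i j" and ij: "i \<in> cobj C" "j \<in> cobj C" for i j g h
  proof -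
    have mem: "g \<in> chom C i j" "h \<in> chom C i j"
      using gh by (auto simp: rel_at_def)
    have "(ccomp C i j j (cid C j) (ccomp C i i j g (cid C i)),
        ccomp C i j j (cid C j) (ccomp C i i j h (cid C i))) \<in> rel_c C R i j"
      unfolding rel_c_def using gh ij cat.id_closed by blast
    then have "(g, h) \<in> rel_c C R i j"
      using mem ij by (simp add: cat.id_left cat.id_right)
    then show ?thesis
      using cat.rel_c_subset_rel_sharp by blast
  qed
  have ker_ideal: "k_ideal K (linearization A C) ?ker"
    by (rule P.k_ideal_kernel) simp
  have ker_relators: "relators R i j \<subseteq> ?ker i j" if ij: "i \<in> cobj C" "j \<in> cobj C" for i j
  proof -
    interpret h: abelian_group_hom "Hom i j" "khom (linearization A ?D) i j" "F.push i j"
      using P.mor_abelian_group_hom[of i j] ij by simp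
    have "F.push i j (lin_single A C i j \<one>\<^bsub>A\<^esub> g \<ominus>\<^bsub>Hom i j\<^esub> lin_single A C i j \<one>\<^bsub>A\<^esub> h)
        = \<zero>\<^bsub>khom (linearization A ?D) i j\<^esub>"
      if gh: "(g, h) \<in> rel_at C R i j" for g h
    proof -
      have mem: "g \<in> chom C i j" "h \<in> chom C i j"
        using gh by (auto simp: rel_at_def)
      then have "fmor ?F i j g = fmor ?F i j h"
        using F_eq[OF ij mem] rel_at_sharp[OF gh ij] by simp
      then show ?thesis
        using mem by (simp add: a_minus_def single_closed F.push_single F.cod.single_closed
            h.H.r_neg)
    qed
    moreover have "lin_single A C i j \<one>\<^bsub>A\<^esub> g \<ominus>\<^bsub>Hom i j\<^esub> lin_single A C i j \<one>\<^bsub>A\<^esub> h \<in> carrier (Hom i j)" for g h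
      by (simp add: single_closed)
    ultimately show ?thesis
      by auto
  qed
  have "f \<in> J i j"
    if J: "k_ideal K (linearization A C) J" and rel: "\<forall>i\<in>cobj C. \<forall>j\<in>cobj C. relators R i j \<subseteq> J i j"
      and f: "f \<in> ?ker i j" for J f
  proof -
    let ?q = "quotient_functor (linearization A C) J"
    have q: "k_functor K (linearization A C) (quotient_kcat (linearization A C) J) ?q"
      using k_category_linearization J by (rule k_functor_quotient)
    have "fmor ?q i j (lin_single A C i j \<one>\<^bsub>A\<^esub> g) = fmor ?q i j (lin_single A C i j \<one>\<^bsub>A\<^esub> h)"
      if "(g, h) \<in> rel_sharp C R i j" "i \<in> cobj C" "j \<in> cobj C" for g h i j
    proof (rule rel_sharp_imp_eq[OF q _ that(2,3,1)])
      fix i j g h assume *: "i \<in> cobj C" "j \<in> cobj C" "(g, h) \<in> rel_at C R i j"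
      then have "lin_single A C i j \<one>\<^bsub>A\<^esub> g \<ominus>\<^bsub>Hom i j\<^esub> lin_single A C i j \<one>\<^bsub>A\<^esub> h \<in> J i j"
        using rel by blast
      then show "fmor ?q i j (lin_single A C i j \<one>\<^bsub>A\<^esub> g) = fmor ?q i j (lin_single A C i j \<one>\<^bsub>A\<^esub> h)"
        using * by (simp add: P.source.quotient_functor_eq_iff[OF J] single_closed)
    qed
    note q_eq = this
    have "fmor ?q i j f = fmor ?q i j \<zero>\<^bsub>Hom i j\<^esub>"
    proof (rule F.push_eq_imp_eq[OF q ij F_full _ _ Hom_zero_closed])
      fix \<mu> \<mu>' assume "\<mu> \<in> chom C i j" "\<mu>' \<in> chom C i j" "fmor ?F i j \<mu> = fmor ?F i j \<mu>'"
      then show "fmor ?q i j (lin_single A C i j \<one>\<^bsub>A\<^esub> \<mu>) = fmor ?q i j (lin_single A C i j \<one>\<^bsub>A\<^esub> \<mu>')"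
        using q_eq[OF _ ij] F_eq[OF ij] by blast
    qed (use f F.push_zero[of i j] in simp_all)
    then have "f \<ominus>\<^bsub>Hom i j\<^esub> \<zero>\<^bsub>Hom i j\<^esub> \<in> J i j"
      using f ij by (simp add: P.source.quotient_functor_eq_iff[OF J] Hom_zero_closed)
    moreover interpret M: Module.module K "Hom i j"
      by (rule Hom_module)
    have "f \<ominus>\<^bsub>Hom i j\<^esub> \<zero>\<^bsub>Hom i j\<^esub> = f"
      using f M.M.minus_equality[of "\<zero>\<^bsub>Hom i j\<^esub>" "\<zero>\<^bsub>Hom i j\<^esub>"] by (simp add: a_minus_def)
    ultimately show ?thesis
      by simp
  qed
  moreover have "ideal_generated K (linearization A C) (relators R) i j \<subseteq> ?ker i j"
    unfolding ideal_generated_def using ker_ideal ker_relators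
    by (intro Inter_lower CollectI exI[of _ ?ker] conjI ballI) simp_all
  ultimately show ?thesis
    unfolding ideal_generated_def by (intro equalityI) auto
qed

text \<open>
  The projection of \<open>C\<close> is the identity on objects and onto on morphisms. So is its linearization,
  and the first isomorphism theorem applies with the kernel just found.
\<close>

theorem linearization_quotient_cat:
  "k_isomorphic K (quotient_kcat (linearization A C) (ideal_generated K (linearization A C) (relators R)))
    (linearization A (quotient_cat C R))"
proof -
  let ?F = "quotient_cat_functor C R" and ?D = "quotient_cat C R"
  interpret F: cat_functor C ?D ?F
    by (rule cat.cat_functor_quotient_cat)
  interpret F: linearized_functor K A C ?D ?F
    by unfold_locales
  have F_obj: "fobj ?F i = i" and D_obj: "cobj ?D = cobj C" for i
    by (simp_all add: quotient_cat_functor_def quotient_cat_def)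
  have F_full: "fmor ?F i j ` chom C i j = chom ?D (fobj ?F i) (fobj ?F j)" for i j
    by (auto simp: quotient_cat_functor_def quotient_cat_def quotient_def)
  show ?thesis
  proof (rule k_isomorphic_quotient_kernel[OF F.k_functor_lin_functor])
    show "bij_betw (fobj (lin_functor A C ?D ?F)) (kobj (linearization A C)) (kobj (linearization A ?D))"
      by (simp add: F_obj D_obj bij_betw_def inj_on_def)
    fix i j assume ij: "i \<in> kobj (linearization A C)" "j \<in> kobj (linearization A C)"
    show "F.push i j ` carrier (Hom i j) = carrier (khom (linearization A ?D)
        (fobj (lin_functor A C ?D ?F) i) (fobj (lin_functor A C ?D ?F) j))"
      using F.push_onto[OF F_full[of i j]] by simp
    show "ideal_generated K (linearization A C) (relators R) i j
      = {f \<in> carrier (Hom i j). F.push i j f = \<zero>\<^bsub>khom (linearization A ?D)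
          (fobj (lin_functor A C ?D ?F) i) (fobj (lin_functor A C ?D ?F) j)\<^esub>}"
      using ideal_generated_relators[of i j R] ij by (simp only: kobj_linearization F.fobj_lin_functor F_obj)
  qed
qed

end

section \<open>The Grothendieck construction of a diagonal functor\<close>

text \<open>
  For the constant functor with value the one-object category \<open>A\<close> and identity transition
  functors, the twist by \<open>X(b)\<close> in the composition disappears, and what remains is the
  composition of the linearization.
\<close>

lemma k_isomorphic_Gr_diagonal:
  fixes A :: "('k, 'a) module" and I :: "('i, 'm) cat"
  assumes "k_algebra K A" "category I"
  shows "k_isomorphic K (linearization A I) (Gr I (diagonal (algebra_kcat A)))"
proof -
  interpret linearized_category K A I
    using assms by (rule linearized_category.intro)
  define F :: "('i, 'm \<Rightarrow> 'a, 'i \<times> unit, 'm \<Rightarrow> 'a) fdata"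
    where "F = \<lparr>fobj = \<lambda>i. (i, ()), fmor = \<lambda>i j f. f\<rparr>"
  let ?G = "Gr I (diagonal (algebra_kcat A))"
  have diag: "dobj (diagonal (algebra_kcat A)) i = algebra_kcat A"
    "fobj (dmor (diagonal (algebra_kcat A)) i j a) x = x"
    "fmor (dmor (diagonal (algebra_kcat A)) i j a) x y f = f" for i j a x y f
    by (simp_all add: diagonal_def functor_id_def)
  have alg: "kobj (algebra_kcat A) = {()}" "khom (algebra_kcat A) x y = A"
    "kid (algebra_kcat A) x = \<one>\<^bsub>A\<^esub>" "kcomp (algebra_kcat A) x y z b a = b \<otimes>\<^bsub>A\<^esub> a" for x y z a b
    by (simp_all add: algebra_kcat_def)
  have hom: "khom ?G (i, ()) (j, ()) = khom (linearization A I) i j" for i j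
    by (simp add: Gr_def diag alg linearization_def)
  have id: "kid ?G (i, ()) = kid (linearization A I) i" for i
    by (simp add: Gr_def diag alg linearization_def lin_single_def cong: if_cong)
  have comp: "kcomp ?G (i, ()) (j, ()) (k, ()) g f = kcomp (linearization A I) i j k g f" for i j k f g
    by (simp add: Gr_def diag alg linearization_def)
  have obj: "fobj F ` kobj (linearization A I) = kobj ?G"
    by (auto simp: F_def Gr_def diag alg)
  have "k_functor K (linearization A I) ?G F"
    by (rule k_functor_onto[OF k_category_linearization obj])
      (simp_all add: F_def hom id comp)
  then show ?thesis
    by (rule k_isomorphicI) (use obj in \<open>simp_all add: F_def hom bij_betw_def inj_on_def\<close>)
qed

lemma category_free_category:
  assumes "wf_digraph Q"
  shows "category (free_category Q)"
proof -
  interpret wf_digraph Q by fact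
  show ?thesis
    by (intro category.intro) (auto simp: free_category_def awalk_Nil_iff awalk_appendI)
qed

theorem theorem2p4:
  fixes K :: "'k ring"
    and A :: "('k, 'a) module"
    and Q :: "('v, 'e) pre_digraph"
    and R :: "(('v \<times> 'e list) \<times> ('v \<times> 'e list)) set"
  assumes "cring K"
    and "k_algebra K A"
    and "wf_digraph Q"
    and "is_relations (free_category Q) R"
  shows "k_isomorphic K
    (Gr (presented_category Q R) (diagonal (algebra_kcat A)))
    (quotient_kcat (quiver_algebra A Q) (relation_ideal K A Q R))"
proof -
  interpret linearized_category K A "free_category Q"
    using assms(2) category_free_category[OF assms(3)] by (rule linearized_category.intro)
  have "category (presented_category Q R)"
    using cat.cat_functor_quotient_cat[of R] unfolding presented_category_def cat_functor_def by blast
  then have "k_isomorphic K (Gr (presented_category Q R) (diagonal (algebra_kcat A)))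
      (linearization A (presented_category Q R))"
    using assms(2) by (intro k_isomorphic_sym[OF k_isomorphic_Gr_diagonal])
  moreover have "k_isomorphic K (linearization A (presented_category Q R))
      (quotient_kcat (quiver_algebra A Q) (relation_ideal K A Q R))"
    unfolding presented_category_def relation_ideal_def quiver_algebra_def
    by (rule k_isomorphic_sym[OF linearization_quotient_cat])
  ultimately show ?thesis
    by (rule k_isomorphic_trans)
qed

end
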